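(* For $p\in(1,\infty)$ let $\theta_p=2\arcsin\big(\frac{2\sqrt{p-1}}p\big)$. Then, for every $p\in(1,\infty)$, every $n,d\in\mathbb{N}\cup\{0\}$ with $n\geq1$ and $d\in\{0,1,\ldots,n\}$, and every function $f:\{-1,1\}^n\to\mathbb{C}$ of degree at most $d$, we have $$\forall\,t\geq0,\qquad\|e^{-t\Delta}f\|_{L_p(\{-1,1\}^n;\mathbb{C})}\geq\left(\frac{(e^t+1)^{\frac{\pi}{2\pi-\theta_p}}-(e^t-1)^{\frac{\pi}{2\pi-\theta_p}}}{(e^t+1)^{\frac{\pi}{2\pi-\theta_p}}+(e^t-1)^{\frac{\pi}{2\pi-\theta_p}}}\right)^d\|f\|_{L_p(\{-1,1\}^n;\mathbb{C})}.$$ Moreover, for every function $f:\{-1,1\}^n\to\mathbb{C}$ in the $d$-th tail space, we have $$\forall\,t\geq0,\qquad\|e^{-t\Delta}f\|_{L_p(\{-1,1\}^n;\mathbb{C})}\leq\left(\frac{(1+e^{-t})^{\frac{\pi}{\theta_p}}-(1-e^{-t})^{\frac{\pi}{\theta_p}}}{(1+e^{-t})^{\frac{\pi}{\theta_p}}+(1-e^{-t})^{\frac{\pi}{\theta_p}}}\right)^d\|f\|_{L_p(\{-1,1\}^n;\mathbb{C})}.$$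
   Context: For $p\in[1,\infty)$, $\|f\|_{L_p(\{-1,1\}^n;\mathbb{C})}=\big(2^{-n}\sum_{\varepsilon\in\{-1,1\}^n}|f(\varepsilon)|^p\big)^{1/p}$. For $A\subseteq\{1,\ldots,n\}$, the Walsh function is $w_A(\varepsilon)=\prod_{i\in A}\varepsilon_i$. Every $f:\{-1,1\}^n\to\mathbb{C}$ has the expansion $f=\sum_{A}\widehat f(A)w_A$ with $\widehat f(A)=2^{-n}\sum_{\delta\in\{-1,1\}^n}f(\delta)w_A(\delta)$. The discrete heat semigroup is $e^{-t\Delta}f=\sum_Ae^{-t|A|}\widehat f(A)w_A$. A function $f$ has degree at most $d$ if $\widehat f(A)=0$ whenever $|A|>d$, and belongs to the $d$-th tail space if $\widehat f(A)=0$ whenever $|A|<d$. *)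

theory Defs
  imports "HOL-Analysis.Analysis"
begin

text \<open>
  A point of the discrete cube is a function on the index set \<open>{1..n}\<close>, made
  canonical by taking the value \<^term>\<open>undefined\<close> outside it, so that the cube has
  exactly \<open>2 ^ n\<close> elements. A function on the cube is a total function on
  \<^typ>\<open>nat \<Rightarrow> real\<close>; every notion below only uses its values on the cube.
\<close>

definition cube :: "nat \<Rightarrow> (nat \<Rightarrow> real) set" where
  "cube n = ({1..n} \<rightarrow>\<^sub>E {-1, 1})"

definition cube_norm :: "nat \<Rightarrow> real \<Rightarrow> ((nat \<Rightarrow> real) \<Rightarrow> complex) \<Rightarrow> real" where
  "cube_norm n p f = ((\<Sum>\<epsilon>\<in>cube n. cmod (f \<epsilon>) powr p) / 2 ^ n) powr (1 / p)"

definition walsh :: "nat set \<Rightarrow> (nat \<Rightarrow> real) \<Rightarrow> real" where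
  "walsh A \<epsilon> = (\<Prod>i\<in>A. \<epsilon> i)"

definition walsh_coeff :: "nat \<Rightarrow> ((nat \<Rightarrow> real) \<Rightarrow> complex) \<Rightarrow> nat set \<Rightarrow> complex" where
  "walsh_coeff n f A = (\<Sum>\<delta>\<in>cube n. f \<delta> * of_real (walsh A \<delta>)) / 2 ^ n"

definition heat :: "nat \<Rightarrow> real \<Rightarrow> ((nat \<Rightarrow> real) \<Rightarrow> complex) \<Rightarrow> (nat \<Rightarrow> real) \<Rightarrow> complex" where
  "heat n t f \<epsilon> =
     (\<Sum>A\<in>Pow {1..n}. of_real (exp (- t * real (card A))) * walsh_coeff n f A * of_real (walsh A \<epsilon>))"

definition degree_at_most :: "nat \<Rightarrow> nat \<Rightarrow> ((nat \<Rightarrow> real) \<Rightarrow> complex) \<Rightarrow> bool" where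
  "degree_at_most n d f \<longleftrightarrow> (\<forall>A. A \<subseteq> {1..n} \<and> card A > d \<longrightarrow> walsh_coeff n f A = 0)"

definition tail_space :: "nat \<Rightarrow> nat \<Rightarrow> ((nat \<Rightarrow> real) \<Rightarrow> complex) set" where
  "tail_space n d = {f. \<forall>A. A \<subseteq> {1..n} \<and> card A < d \<longrightarrow> walsh_coeff n f A = 0}"

definition theta :: "real \<Rightarrow> real" where
  "theta p = 2 * arcsin (2 * sqrt (p - 1) / p)"

end

theory Submission
  imports Defs "HOL-Complex_Analysis.Complex_Analysis"
begin

text \<open>
  Both bounds come from the complex noise operators, which multiply the Walsh function of \<open>A\<close> by
  \<open>w ^ card A\<close>; the heat semigroup is the case \<open>w = exp (- t)\<close>. Weissler's theorem for equal
  exponents says that such an operator is a contraction of \<open>L\<^sub>p\<close> for \<open>w\<close> in the lens with corners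
  \<open>-1\<close>, \<open>1\<close> and angle \<open>theta p\<close> there; on the boundary of the lens this is \<open>noise_contraction\<close>.
  Pairing with a function in the dual space gives a polynomial in \<open>w\<close> bounded on the boundary of the lens.
  For \<open>f\<close> in the tail space this polynomial vanishes to order \<open>d\<close> at \<open>0\<close>, so Schwarz's lemma in the
  lens gives decay by the \<open>d\<close>-th power of the Riemann map (\<open>schwarz_high_order\<close>). For \<open>f\<close> of degree
  at most \<open>d\<close>, the polynomial belonging to the noised function has degree at most \<open>d\<close>, and the same
  argument in the exterior of the lens bounds it at \<open>exp t\<close>, where it returns \<open>f\<close>
  (\<open>schwarz_low_degree\<close>). The fractions in the theorem are the two Riemann maps.

  Contractivity tensorises, so everything rests on a two-point inequality for complex numbers
  (\<open>weissler_two_point\<close>). By duality \<open>1 < p < 2\<close> may be assumed; put \<open>c = 2/p - 1\<close>. The left-hand side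
  is then bounded by a tangent functional of a concave function, the phases are eliminated
  by maximising over them, and an inequality between hyperbolic functions remains
  (\<open>hyperbolic_key_inequality\<close>), with \<open>X\<close> measuring \<open>\<bar>x\<bar> / \<bar>y\<bar>\<close> and \<open>Y\<close> selecting the
  functional. For a suitable \<open>Y\<close> that does not depend on \<open>c\<close> it follows from an inequality that is an
  equality at both ends \<open>c = 0\<close> and \<open>c = 1\<close>, that is, at \<open>p = 2\<close> and \<open>p = 1\<close>. As a function of \<open>c\<close> its
  difference of sides is an exponential polynomial that can change sign only four times in all; it
  also vanishes at \<open>c = -1\<close>, and its sign at \<open>c = -1/2\<close>, which is an algebraic matter
  (\<open>half_point_hyperbolic\<close>), forces the sign in between \<open>0\<close> and \<open>1\<close>.
\<close>

section \<open>An algebraic inequality\<close>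

text \<open>
  In the barycentric coordinates \<open>b\<close>, \<open>h = a - b\<close>, \<open>k = 1 - a\<close> of the triangle
  \<open>0 \<le> b \<le> a \<le> 1\<close>, and after multiplying each monomial by the power of \<open>b + h + k = 1\<close> that makes the
  polynomial homogeneous, all coefficients become nonnegative.
\<close>

lemma half_point_polynomials_nonneg:
  fixes a b :: real
  assumes "0 \<le> b" "b \<le> a" "a \<le> 1"
  shows "0 \<le> 33*b^2 - 30*b^3 + b^4 + 14*a*b + 60*a*b^2 - 84*a*b^3 - 4*a*b^4 - 2*a*b^5 + a^2
    + 2*a^2*b - 27*a^2*b^2 + 8*a^2*b^3 + 69*a^2*b^4 - 30*a^2*b^5 + a^2*b^6 - 2*a^3*b - 68*a^3*b^2
    + 12*a^3*b^3 + 60*a^3*b^4 - 18*a^3*b^5 + a^4*b^2 + 2*a^4*b^3 + a^4*b^4" (is "0 \<le> ?P")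
    and "0 \<le> 6*b - 3*b^2 - b^3 + 2*a + 18*a*b - 14*a*b^2 - 13*a*b^3 + a*b^4 + a^2 + 15*a^2*b
    - 2*a^2*b^2 - 8*a^2*b^3 - a^3*b - a^3*b^2" (is "0 \<le> ?L")
proof -
  define h where "h = a - b"
  define k where "k = 1 - a"
  have nn: "0 \<le> h" "0 \<le> k" "0 \<le> b" using assms by (auto simp: h_def k_def)
  have "?P = 256*b^6*h*k + 256*b^6*k^2 + 64*b^5*h^3 + 1216*b^5*h^2*k + 1920*b^5*h*k^2 + 768*b^5*k^3
    + 212*b^4*h^4 + 2256*b^4*h^3*k + 4544*b^4*h^2*k^2 + 3264*b^4*h*k^3 + 768*b^4*k^4 + 252*b^3*h^5
    + 2004*b^3*h^4*k + 4632*b^3*h^3*k^2 + 4576*b^3*h^2*k^3 + 2016*b^3*h*k^4 + 320*b^3*k^5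
    + 125*b^2*h^6 + 830*b^2*h^5*k + 2045*b^2*h^4*k^2 + 2452*b^2*h^3*k^3 + 1512*b^2*h^2*k^4
    + 448*b^2*h*k^5 + 48*b^2*k^6 + 22*b*h^7 + 128*b*h^6*k + 308*b*h^5*k^2 + 392*b*h^4*k^3
    + 278*b*h^3*k^4 + 104*b*h^2*k^5 + 16*b*h*k^6 + h^8 + 6*h^7*k + 15*h^6*k^2 + 20*h^5*k^3
    + 15*h^4*k^4 + 6*h^3*k^5 + h^2*k^6"
    unfolding h_def k_def by algebra
  also have "\<dots> \<ge> 0" using nn by (intro add_nonneg_nonneg mult_nonneg_nonneg zero_le_power) auto
  finally show "0 \<le> ?P" .
  have "?L = 64*b^4*h + 64*b^4*k + 176*b^3*h^2 + 272*b^3*h*k + 96*b^3*k^2 + 162*b^2*h^3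
    + 348*b^2*h^2*k + 232*b^2*h*k^2 + 48*b^2*k^3 + 53*b*h^4 + 151*b*h^3*k + 150*b*h^2*k^2
    + 60*b*h*k^3 + 8*b*k^4 + 3*h^5 + 11*h^4*k + 15*h^3*k^2 + 9*h^2*k^3 + 2*h*k^4"
    unfolding h_def k_def by algebra
  also have "\<dots> \<ge> 0" using nn by (intro add_nonneg_nonneg mult_nonneg_nonneg zero_le_power) auto
  finally show "0 \<le> ?L" .
qed

text \<open>
  The second square root is bounded by the arithmetic-geometric mean inequality, which is tangent at
  \<open>a = b\<close>, where the claim degenerates to an equality. For the first one that bound would be too weak, so it
  is isolated and squared. The difference of the
  squares is \<open>(a - b)\<^sup>2\<close> times the first polynomial of the preceding lemma.
\<close>

lemma half_point_algebraic:
  fixes a b :: real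
  assumes "0 \<le> b" "b < a" "a < 1"
  defines "D \<equiv> (a - b) * (1 - a * b)"
    and "U \<equiv> a * (1 + b)\<^sup>2 + b * (1 + a)\<^sup>2"
  shows "(U - D/2) * sqrt ((1 + a) * (1 + b)) + D/2 * (1 + b) * sqrt ((1 - a)/(1 - b))
     \<le> U + 2 * a * b * (1 + a) * (1 + b)"
proof -
  define L where "L = (U + 2 * a * b * (1 + a) * (1 + b)) * 4 * (1 - b) - D * (1 + b) * (2 - a - b)"
  define M where "M = (U - D/2) * 4 * (1 - b)"
  have D0: "0 \<le> D" using assms by (auto simp: D_def intro!: mult_nonneg_nonneg mult_le_one)
  have L_eq: "L = 6*b - 3*b^2 - b^3 + 2*a + 18*a*b - 14*a*b^2 - 13*a*b^3 + a*b^4 + a^2 + 15*a^2*b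
    - 2*a^2*b^2 - 8*a^2*b^3 - a^3*b - a^3*b^2"
    unfolding L_def D_def U_def by algebra
  have L0: "0 \<le> L" unfolding L_eq using half_point_polynomials_nonneg(2)[of b a] assms by simp
  have "L\<^sup>2 - M\<^sup>2 * ((1 + a) * (1 + b)) = (a - b)\<^sup>2 *
    (33*b^2 - 30*b^3 + b^4 + 14*a*b + 60*a*b^2 - 84*a*b^3 - 4*a*b^4 - 2*a*b^5 + a^2
    + 2*a^2*b - 27*a^2*b^2 + 8*a^2*b^3 + 69*a^2*b^4 - 30*a^2*b^5 + a^2*b^6 - 2*a^3*b - 68*a^3*b^2
    + 12*a^3*b^3 + 60*a^3*b^4 - 18*a^3*b^5 + a^4*b^2 + 2*a^4*b^3 + a^4*b^4)"
    unfolding L_def M_def D_def U_def by (simp add: field_simps) algebra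
  also have "\<dots> \<ge> 0" using half_point_polynomials_nonneg(1)[of b a] assms by (intro mult_nonneg_nonneg) auto
  finally have "M\<^sup>2 * ((1 + a) * (1 + b)) \<le> L\<^sup>2" by simp
  then have "(M * sqrt ((1 + a) * (1 + b)))\<^sup>2 \<le> L\<^sup>2"
    using assms by (simp add: power_mult_distrib)
  then have M_le_L: "M * sqrt ((1 + a) * (1 + b)) \<le> L"
    using L0 by (metis abs_le_square_iff abs_of_nonneg abs_ge_self order_trans)
  have "sqrt ((1 - a)/(1 - b)) \<le> (2 - a - b) / (2 * (1 - b))"
  proof -
    have "sqrt (1 * ((1 - a)/(1 - b))) \<le> (1 + (1 - a)/(1 - b)) / 2"
      using assms by (intro arith_geo_mean_sqrt) auto
    also have "\<dots> = (2 - a - b) / (2 * (1 - b))" using assms by (simp add: field_simps)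
    finally show ?thesis by simp
  qed
  then have "D/2 * (1 + b) * sqrt ((1 - a)/(1 - b)) \<le> D/2 * (1 + b) * ((2 - a - b) / (2 * (1 - b)))"
    using D0 assms by (intro mult_left_mono) auto
  also have "\<dots> = D * (1 + b) * (2 - a - b) / (4 * (1 - b))" by simp
  finally have 1: "D/2 * (1 + b) * sqrt ((1 - a)/(1 - b)) \<le> D * (1 + b) * (2 - a - b) / (4 * (1 - b))" .
  have "(U - D/2) * sqrt ((1 + a) * (1 + b)) = M * sqrt ((1 + a) * (1 + b)) / (4 * (1 - b))"
    using assms(2,3) \<open>0 \<le> b\<close> unfolding M_def by (simp add: field_simps del: real_sqrt_mult)
  also have "\<dots> \<le> L / (4 * (1 - b))" using M_le_L assms by (intro divide_right_mono) auto
  also have "\<dots> = U + 2 * a * b * (1 + a) * (1 + b) - D * (1 + b) * (2 - a - b) / (4 * (1 - b))"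
    using assms by (simp add: L_def field_simps)
  finally show ?thesis using 1 by simp
qed

text \<open>
  With \<open>a = tanh (X/2)\<close> and \<open>b = tanh (Y/2)\<close> the constraint gives
  \<open>s = (a + b) * (1 + a * b) / ((a - b) * (1 - a * b))\<close>, and everything is algebraic in \<open>a\<^sup>2\<close>, \<open>b\<^sup>2\<close>.
  The inequality gives the sign at \<open>c = -1/2\<close> of the function whose sign on \<open>{0..1}\<close> is determined below; that
  parameter is chosen because the powers of \<open>cosh X / cosh Y\<close> are then square roots.
\<close>

lemma half_point_hyperbolic:
  fixes X Y s :: real
  assumes "1 \<le> s" "0 < X" "0 \<le> Y" and rel: "tanh Y * (s + 1) = tanh X * (s - 1)"
  shows "(s/2 + 1/(2 * s) - 1/2) * sqrt (cosh X * cosh Y) + cosh Y / 2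
     \<le> s/2 * cosh ((X + Y)/2) + 1/(2 * s) * cosh ((X - Y)/2)"
proof -
  define a where "a = tanh (X/2)"
  define b where "b = tanh (Y/2)"
  define P where "P = cosh (X/2)"
  define Q where "Q = cosh (Y/2)"
  define R where "R = sqrt ((1 + a\<^sup>2) * (1 + b\<^sup>2))"
  have tX: "0 < tanh X" using assms by simp
  have "tanh Y * (s + 1) < tanh X * (s + 1)" unfolding rel
    using assms tX by (intro mult_strict_left_mono) auto
  then have "tanh Y < tanh X" using \<open>1 \<le> s\<close> by (simp add: mult_less_cancel_right)
  then have YX: "Y < X" by simp
  have ab: "0 \<le> b" "b < a" "a < 1" using assms YX by (auto simp: a_def b_def tanh_real_lt_1)
  have sq1: "b\<^sup>2 < a\<^sup>2" "a\<^sup>2 < 1" "0 \<le> b\<^sup>2"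
    using power_strict_mono[of b a 2] power_strict_mono[of a 1 2] ab by auto
  have ab1: "a * b < 1" using mult_strict_mono[of a 1 b 1] ab by (cases "b = 0") auto
  have PQ: "0 < P" "0 < Q" by (auto simp: P_def Q_def)
  have shP: "sinh (X/2) = a * P" "sinh (Y/2) = b * Q"
    by (auto simp: a_def b_def P_def Q_def tanh_def)
  have P1: "P\<^sup>2 * (1 - a\<^sup>2) = 1" "Q\<^sup>2 * (1 - b\<^sup>2) = 1"
    using cosh_square_eq[of "X/2"] cosh_square_eq[of "Y/2"] shP
    by (auto simp: P_def[symmetric] Q_def[symmetric] power_mult_distrib algebra_simps)
  have cX: "cosh X = P\<^sup>2 * (1 + a\<^sup>2)" "cosh Y = Q\<^sup>2 * (1 + b\<^sup>2)"
    using cosh_double_cosh[of "X/2"] cosh_double_cosh[of "Y/2"] P1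
    by (auto simp: P_def[symmetric] Q_def[symmetric] algebra_simps)
  have sX: "sinh X = P\<^sup>2 * (2 * a)" "sinh Y = Q\<^sup>2 * (2 * b)"
    using sinh_double[of "X/2"] sinh_double[of "Y/2"] shP
    by (auto simp: P_def[symmetric] Q_def[symmetric] power2_eq_square)
  have tt: "tanh X = 2 * a / (1 + a\<^sup>2)" "tanh Y = 2 * b / (1 + b\<^sup>2)"
    using PQ by (auto simp: tanh_def cX sX)
  have pos: "0 < 1 + a\<^sup>2" "0 < 1 + b\<^sup>2" by (auto simp: add_pos_nonneg)
  define n where "n = (a + b) * (1 + a * b)"
  define m where "m = (a - b) * (1 - a * b)"
  have nm: "0 < n" "0 < m" using ab ab1 by (auto simp: n_def m_def add_pos_nonneg)
  \<comment> \<open>The relation between \<open>X\<close>, \<open>Y\<close> and \<open>s\<close> becomes rational in the half-angle coordinates.\<close>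
  have "b * (1 + a\<^sup>2) * (s + 1) = a * (1 + b\<^sup>2) * (s - 1)"
    using rel pos unfolding tt by (simp add: field_simps)
  then have "s * m = n" by (simp add: n_def m_def power2_eq_square algebra_simps)
  then have s_eq: "s = n / m" using nm by (simp add: field_simps)
  have D: "(a\<^sup>2 - b\<^sup>2) * (1 - a\<^sup>2 * b\<^sup>2) = n * m" unfolding n_def m_def by algebra
  have U: "a\<^sup>2 * (1 + b\<^sup>2)\<^sup>2 + b\<^sup>2 * (1 + a\<^sup>2)\<^sup>2 = (n\<^sup>2 + m\<^sup>2) / 2"
    unfolding n_def m_def by (simp add: field_simps) algebra
  have V: "(n\<^sup>2 + m\<^sup>2) / 2 + 2 * a\<^sup>2 * b\<^sup>2 * (1 + a\<^sup>2) * (1 + b\<^sup>2)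
      = (n\<^sup>2 * (1 + a * b) + m\<^sup>2 * (1 - a * b)) / 2"
    unfolding n_def m_def by (simp add: field_simps) algebra
  have QP: "sqrt ((1 - a\<^sup>2) / (1 - b\<^sup>2)) = Q / P"
  proof -
    have "(1 - a\<^sup>2) / (1 - b\<^sup>2) = (Q / P)\<^sup>2"
      using P1 PQ sq1 by (simp add: field_simps)
    then show ?thesis using PQ by simp
  qed
  have "((n\<^sup>2 + m\<^sup>2) / 2 - n * m / 2) * R + n * m / 2 * (1 + b\<^sup>2) * (Q / P)
      \<le> (n\<^sup>2 * (1 + a * b) + m\<^sup>2 * (1 - a * b)) / 2"
    using half_point_algebraic[of "b\<^sup>2" "a\<^sup>2"] sq1 unfolding D U V QP R_def by simp
  then have "(((n\<^sup>2 + m\<^sup>2) / 2 - n * m / 2) * R + n * m / 2 * (1 + b\<^sup>2) * (Q / P)) / (n * m) * (P * Q)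
      \<le> ((n\<^sup>2 * (1 + a * b) + m\<^sup>2 * (1 - a * b)) / 2) / (n * m) * (P * Q)"
    using nm PQ by (intro mult_right_mono divide_right_mono) auto
  moreover have "sqrt (cosh X * cosh Y) = P * Q * R"
  proof -
    have "cosh X * cosh Y = (P * Q)\<^sup>2 * ((1 + a\<^sup>2) * (1 + b\<^sup>2))"
      unfolding cX by (simp add: power_mult_distrib)
    then show ?thesis using PQ by (simp add: real_sqrt_mult R_def)
  qed
  then have "(((n\<^sup>2 + m\<^sup>2) / 2 - n * m / 2) * R + n * m / 2 * (1 + b\<^sup>2) * (Q / P)) / (n * m) * (P * Q)
     = (s/2 + 1/(2 * s) - 1/2) * sqrt (cosh X * cosh Y) + cosh Y / 2"
    unfolding s_eq using nm PQ by (simp add: cX field_simps power2_eq_square)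
  moreover have "cosh ((X + Y)/2) = P * Q * (1 + a * b)" "cosh ((X - Y)/2) = P * Q * (1 - a * b)"
    using cosh_add[of "X/2" "Y/2"] cosh_diff[of "X/2" "Y/2"] shP
    by (auto simp: add_divide_distrib diff_divide_distrib P_def[symmetric] Q_def[symmetric] algebra_simps)
  then have "((n\<^sup>2 * (1 + a * b) + m\<^sup>2 * (1 - a * b)) / 2) / (n * m) * (P * Q)
     = s/2 * cosh ((X + Y)/2) + 1/(2 * s) * cosh ((X - Y)/2)"
    unfolding s_eq using nm by (simp only:) (simp add: field_simps power2_eq_square)
  ultimately show ?thesis by simp
qed

section \<open>An interpolation inequality for hyperbolic functions\<close>

text \<open>
  A sign count by Rolle's theorem. If \<open>f\<close> had the weak signs \<open>-, +, -, +, -\<close> at the five points,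
  strict at the fourth, then \<open>f'\<close> would alternate in sign at four points and \<open>g\<close> at three,
  being positive at the middle one and nonpositive at the outer ones, against convexity.
\<close>

lemma sign_pattern_of_exp_convex:
  fixes f f' g :: "real \<Rightarrow> real" and l :: real
  assumes f: "\<And>x. (f has_real_derivative f' x) (at x)"
    and f': "\<And>x. (f' has_real_derivative exp (- l * x) * g x) (at x)"
    and g: "convex_on UNIV g"
    and ord: "t0 < t1" "t1 < t2" "t2 < t3" "t3 < t4"
    and val: "f t0 \<le> 0" "0 \<le> f t1" "f t2 \<le> 0" "f t4 \<le> 0"
  shows "f t3 \<le> 0"
proof (rule ccontr)
  assume pos: "\<not> f t3 \<le> 0"
  have mvt: "\<exists>z. a < z \<and> z < b \<and> h b - h a = (b - a) * h' z"
    if "a < b" "\<And>x. (h has_real_derivative h' x) (at x)" for a b and h h' :: "real \<Rightarrow> real"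
    using MVT2[of a b h h'] that by blast
  obtain s1 where s1: "t0 < s1" "s1 < t1" "f t1 - f t0 = (t1 - t0) * f' s1"
    using mvt[OF ord(1) f] by blast
  obtain s2 where s2: "t1 < s2" "s2 < t2" "f t2 - f t1 = (t2 - t1) * f' s2"
    using mvt[OF ord(2) f] by blast
  obtain s3 where s3: "t2 < s3" "s3 < t3" "f t3 - f t2 = (t3 - t2) * f' s3"
    using mvt[OF ord(3) f] by blast
  obtain s4 where s4: "t3 < s4" "s4 < t4" "f t4 - f t3 = (t4 - t3) * f' s4"
    using mvt[OF ord(4) f] by blast
  have "0 \<le> (t1 - t0) * f' s1" "(t2 - t1) * f' s2 \<le> 0" "0 < (t3 - t2) * f' s3" "(t4 - t3) * f' s4 < 0"
    using s1 s2 s3 s4 val pos by linarith+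
  then have d: "0 \<le> f' s1" "f' s2 \<le> 0" "0 < f' s3" "f' s4 < 0"
    using ord by (auto simp: zero_le_mult_iff zero_less_mult_iff mult_le_0_iff mult_less_0_iff)
  have ords: "s1 < s2" "s2 < s3" "s3 < s4" using s1 s2 s3 s4 by linarith+
  obtain r1 where r1: "s1 < r1" "r1 < s2" "f' s2 - f' s1 = (s2 - s1) * (exp (- l * r1) * g r1)"
    using mvt[OF ords(1) f'] by blast
  obtain r2 where r2: "s2 < r2" "r2 < s3" "f' s3 - f' s2 = (s3 - s2) * (exp (- l * r2) * g r2)"
    using mvt[OF ords(2) f'] by blast
  obtain r3 where r3: "s3 < r3" "r3 < s4" "f' s4 - f' s3 = (s4 - s3) * (exp (- l * r3) * g r3)"
    using mvt[OF ords(3) f'] by blast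
  have "(s2 - s1) * (exp (- l * r1) * g r1) \<le> 0" "0 < (s3 - s2) * (exp (- l * r2) * g r2)"
       "(s4 - s3) * (exp (- l * r3) * g r3) \<le> 0"
    using r1 r2 r3 d by linarith+
  then have G: "g r1 \<le> 0" "0 < g r2" "g r3 \<le> 0"
    using ords by (auto simp: zero_less_mult_iff mult_le_0_iff)
  have r: "r1 < r2" "r2 < r3" using r1 r2 r3 by linarith+
  then have "convex_on {r1..r3} g" using g convex_on_subset by blast
  then have "g r2 \<le> (g r3 - g r1) / (r3 - r1) * (r2 - r1) + g r1"
    using r by (intro convex_onD_Icc') auto
  also have "\<dots> = (g r1 * (r3 - r2) + g r3 * (r2 - r1)) / (r3 - r1)"
    using r by (simp add: field_simps)
  also have "\<dots> \<le> 0" using r G by (intro divide_nonpos_pos add_nonpos_nonpos mult_nonpos_nonneg) auto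
  finally show False using G by simp
qed

text \<open>
  The function is \<open>(D - l)\<^sup>2\<close> applied to \<open>cosh (a + k * c)\<close>: a combination of \<open>exp (k * c)\<close> and
  \<open>exp (- k * c)\<close> with the nonnegative weights \<open>(k - l)\<^sup>2\<close> and \<open>(k + l)\<^sup>2\<close>.
\<close>

lemma convex_shifted_cosh:
  fixes a k l :: real
  shows "convex_on UNIV (\<lambda>c. (k\<^sup>2 + l\<^sup>2) * cosh (a + k * c) - 2 * l * k * sinh (a + k * c))"
proof (rule f''_ge0_imp_convex)
  show "((\<lambda>c. (k\<^sup>2 + l\<^sup>2) * cosh (a + k * c) - 2 * l * k * sinh (a + k * c)) has_real_derivative
     k * ((k\<^sup>2 + l\<^sup>2) * sinh (a + k * x) - 2 * l * k * cosh (a + k * x))) (at x)" for x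
    by (auto intro!: derivative_eq_intros simp: algebra_simps)
  show "((\<lambda>c. k * ((k\<^sup>2 + l\<^sup>2) * sinh (a + k * c) - 2 * l * k * cosh (a + k * c))) has_real_derivative
     k\<^sup>2 * ((k\<^sup>2 + l\<^sup>2) * cosh (a + k * x) - 2 * l * k * sinh (a + k * x))) (at x)" for x
    by (auto intro!: derivative_eq_intros simp: algebra_simps power2_eq_square)
  show "0 \<le> k\<^sup>2 * ((k\<^sup>2 + l\<^sup>2) * cosh (a + k * x) - 2 * l * k * sinh (a + k * x))" for x
  proof -
    have "cosh z = (exp z + exp (-z)) / 2" "sinh z = (exp z - exp (-z)) / 2" for z :: real
      by (auto simp: cosh_def sinh_def)
    then have "(k\<^sup>2 + l\<^sup>2) * cosh z - 2 * l * k * sinh z = ((k - l)\<^sup>2 * exp z + (k + l)\<^sup>2 * exp (-z)) / 2" for z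
      by (simp only:) (simp add: field_simps power2_eq_square)
    then show ?thesis by (simp only:) simp
  qed
qed simp

text \<open>
  The difference \<open>N c\<close> of the two sides is studied as a function of all real \<open>c\<close>. It vanishes at
  \<open>c = 0\<close> and, by the constraint on \<open>Y\<close>, at \<open>c = 1\<close>, and it also vanishes at \<open>c = -1\<close>. With
  \<open>l = ln (cosh X / cosh Y)\<close>, the operator \<open>D\<^sup>2 (D - l)\<^sup>2\<close> kills its two terms \<open>c * cosh Y\<close> and
  \<open>(C + c) * cosh X * exp (l * c)\<close> and is nonnegative on the rest. So \<open>exp (- l * c) * N c\<close> is
  subject to the preceding sign count, and its sign at \<open>-1/2\<close> decides the one on the unit interval.
\<close>

lemma hyperbolic_interpolation:
  fixes X Y s c :: real
  assumes s: "1 \<le> s" and X: "0 < X" and Y: "0 \<le> Y" and rel: "tanh Y * (s + 1) = tanh X * (s - 1)"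
    and c: "0 < c" "c < 1"
  shows "s/2 * cosh (X + c * (X - Y)) + 1/(2 * s) * cosh (X + c * (X + Y)) + c * cosh Y
     \<le> (s/2 + 1/(2 * s) + c) * cosh X * (cosh X / cosh Y) powr c"
proof -
  define E where "E = s/2"
  define e where "e = 1/(2 * s)"
  define C where "C = s/2 + 1/(2 * s)"
  define l where "l = ln (cosh X / cosh Y)"
  define H where "H = (\<lambda>c. E * cosh (X + (X - Y) * c) + e * cosh (X + (X + Y) * c) + c * cosh Y)"
  define H' where "H' = (\<lambda>c. E * ((X - Y) * sinh (X + (X - Y) * c)) + e * ((X + Y) * sinh (X + (X + Y) * c)) + cosh Y)"
  define f where "f = (\<lambda>c. exp (- l * c) * H c - (C + c) * cosh X)"
  define f' where "f' = (\<lambda>c. exp (- l * c) * (H' c - l * H c) - cosh X)"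
  define K where "K = (\<lambda>k c. (k\<^sup>2 + l\<^sup>2) * cosh (X + k * c) - 2 * l * k * sinh (X + k * c))"
  define g where "g = (\<lambda>c. (E * K (X - Y) c + e * K (X + Y) c) + cosh Y * (l\<^sup>2 * c - 2 * l))"
  have chp: "0 < cosh X" "0 < cosh Y" by auto
  have el: "exp l = cosh X / cosh Y" unfolding l_def using chp by simp
  have f: "(f has_real_derivative f' x) (at x)" for x
    unfolding f_def f'_def H_def H'_def
    by (auto intro!: derivative_eq_intros simp: algebra_simps)
  have f': "(f' has_real_derivative exp (- l * x) * g x) (at x)" for x
    unfolding f'_def H_def H'_def g_def K_def
    by (auto intro!: derivative_eq_intros simp: algebra_simps power2_eq_square)
  have g: "convex_on UNIV g"
  proof -
    have "convex_on UNIV (\<lambda>c::real. l\<^sup>2 * c - 2 * l)"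
      by (rule f''_ge0_imp_convex[where f' = "\<lambda>_. l\<^sup>2" and f'' = "\<lambda>_. 0"])
         (auto intro!: derivative_eq_intros)
    then show ?thesis unfolding g_def K_def
      using s by (intro convex_on_add convex_on_cmul convex_shifted_cosh) (auto simp: E_def e_def)
  qed
  have "f (-1) = 0"
  proof -
    have "H (-1) = C * cosh Y - cosh Y" unfolding H_def C_def E_def e_def by (simp add: algebra_simps)
    then have "f (-1) = exp l * (C * cosh Y - cosh Y) - (C - 1) * cosh X" unfolding f_def by simp
    then show ?thesis unfolding el using chp by (simp add: field_simps)
  qed
  moreover have "0 \<le> f (-1/2)"
  proof -
    have e: "exp (l / 2) = sqrt (cosh X * cosh Y) / cosh Y"
    proof (rule power2_eq_imp_eq)
      have "(exp (l/2))\<^sup>2 = exp l" by (simp add: exp_double[symmetric])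
      then show "(exp (l / 2))\<^sup>2 = (sqrt (cosh X * cosh Y) / cosh Y)\<^sup>2"
        unfolding el using chp by (simp add: power_divide power2_eq_square)
    qed (use chp in auto)
    have H: "(C - 1/2) * sqrt (cosh X * cosh Y) \<le> H (-1/2)"
    proof -
      have "X + (X - Y) * (-1/2) = (X + Y)/2" "X + (X + Y) * (-1/2) = (X - Y)/2"
        by (auto simp: field_simps)
      then have "H (-1/2) = s/2 * cosh ((X + Y)/2) + 1/(2 * s) * cosh ((X - Y)/2) - cosh Y / 2"
        unfolding H_def E_def e_def by (simp only:)
      then show ?thesis unfolding C_def using half_point_hyperbolic[OF s X Y rel] by linarith
    qed
    have "(C - 1/2) * cosh X = sqrt (cosh X * cosh Y) / cosh Y * ((C - 1/2) * sqrt (cosh X * cosh Y))"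
      using chp by (simp add: field_simps)
    also have "\<dots> \<le> sqrt (cosh X * cosh Y) / cosh Y * H (-1/2)"
      using chp H by (intro mult_left_mono) auto
    finally show ?thesis unfolding f_def by (simp add: e)
  qed
  moreover have "f 0 = 0" unfolding f_def H_def C_def E_def e_def by (simp add: algebra_simps)
  moreover have "f 1 = 0"
  proof -
    have CS: "s/2 * cosh (2 * X - Y) + 1/(2 * s) * cosh (2 * X + Y)
      = C * cosh (2 * X) * cosh Y - (s/2 - 1/(2 * s)) * sinh (2 * X) * sinh Y"
      unfolding C_def by (simp add: cosh_add cosh_diff algebra_simps)
    have r: "sinh Y * cosh X * (s + 1) = sinh X * cosh Y * (s - 1)"
      using rel chp by (simp add: tanh_def field_simps)
    have id: "cosh X ^ 2 = sinh X ^ 2 + 1" "cosh Y ^ 2 = sinh Y ^ 2 + 1"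
      by (simp_all add: cosh_square_eq)
    have "(s/2 * cosh (2 * X - Y) + 1/(2 * s) * cosh (2 * X + Y) + cosh Y) * cosh Y = (C + 1) * (cosh X)\<^sup>2"
    proof -
      have "(s + 1)\<^sup>2 * (cosh X)\<^sup>2 = (((s\<^sup>2 + 1) * (2 * (cosh X)\<^sup>2 - 1)) * cosh Y - (s\<^sup>2 - 1) * (2 * sinh X * cosh X) * sinh Y
          + 2 * s * cosh Y) * cosh Y"
        using r id by algebra
      moreover have "(C + 1) * (cosh X)\<^sup>2 = (s + 1)\<^sup>2 * (cosh X)\<^sup>2 / (2 * s)"
        unfolding C_def using s by (simp add: field_simps power2_eq_square)
      moreover have "(s/2 * cosh (2 * X - Y) + 1/(2 * s) * cosh (2 * X + Y) + cosh Y) * cosh Y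
        = (((s\<^sup>2 + 1) * (2 * (cosh X)\<^sup>2 - 1)) * cosh Y - (s\<^sup>2 - 1) * (2 * sinh X * cosh X) * sinh Y
          + 2 * s * cosh Y) * cosh Y / (2 * s)"
        unfolding CS C_def sinh_double cosh_double_cosh using s
        by (simp add: field_simps power2_eq_square)
      ultimately show ?thesis by simp
    qed
    moreover have "H 1 = s/2 * cosh (2 * X - Y) + 1/(2 * s) * cosh (2 * X + Y) + cosh Y"
      unfolding H_def E_def e_def by (simp add: algebra_simps)
    ultimately have "H 1 * cosh Y = (C + 1) * (cosh X)\<^sup>2" by simp
    then show ?thesis unfolding f_def using chp
      by (simp add: exp_minus el field_simps power2_eq_square)
  qed
  ultimately have "f c \<le> 0"
    using sign_pattern_of_exp_convex[OF f f' g, of "-1" "-1/2" 0 c 1] c by simp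
  then have "exp (- l * c) * H c * exp (l * c) \<le> (C + c) * cosh X * exp (l * c)"
    unfolding f_def by (intro mult_right_mono) auto
  moreover have "exp (- l * c) * H c * exp (l * c) = H c" by (simp add: exp_minus)
  moreover have "(cosh X / cosh Y) powr c = exp (l * c)"
    unfolding powr_def l_def using chp by (simp add: mult.commute)
  ultimately show ?thesis unfolding H_def C_def E_def e_def by (simp add: algebra_simps)
qed

lemma sinh_scaled_le:
  fixes c y :: real
  assumes "0 \<le> c" "c \<le> 1" "0 \<le> y"
  shows "sinh (c * y) \<le> c * sinh y"
proof -
  have "c * sinh 0 - sinh (c * 0) \<le> c * sinh y - sinh (c * y)"
  proof (rule DERIV_nonneg_imp_nondecreasing[OF \<open>0 \<le> y\<close>])
    fix x :: real assume x: "0 \<le> x" "x \<le> y"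
    have "((\<lambda>y. c * sinh y - sinh (c * y)) has_real_derivative c * (cosh x - cosh (c * x))) (at x)"
      by (auto intro!: derivative_eq_intros simp: algebra_simps)
    moreover have "cosh (c * x) \<le> cosh x"
      using assms x by (subst cosh_real_nonneg_le_iff) (auto intro: mult_left_le_one_le)
    ultimately show "\<exists>D. ((\<lambda>y. c * sinh y - sinh (c * y)) has_real_derivative D) (at x) \<and> 0 \<le> D"
      using assms by (intro exI[of _ "c * (cosh x - cosh (c * x))"]) auto
  qed
  then show ?thesis by simp
qed

text \<open>
  The number \<open>Y\<close> is taken from \<open>tanh Y = tanh X * ((s - 1) / (s + 1))\<close>. For \<open>c = 1\<close> this is the only choice that
  works, and it gives equality; for small \<open>X\<close> the second order terms of the difference form a
  multiple of \<open>(Y * (s + 1) - X * (s - 1))\<^sup>2\<close>, whatever \<open>c\<close> is, so that there is no freedom to first order either.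
\<close>

lemma hyperbolic_key_inequality:
  fixes c s X :: real
  assumes c: "0 < c" "c < 1" and s: "1 \<le> s" and X: "0 \<le> X"
  obtains Y where
    "s/2 * cosh ((1 + c) * X - c * Y) + 1/(2 * s) * cosh ((1 + c) * X + c * Y)
        + sqrt (c\<^sup>2 + (sinh (c * Y))\<^sup>2)
     \<le> (s/2 + 1/(2 * s) + c) * cosh X * (cosh X / cosh Y) powr c"
proof (cases "X = 0")
  case True
  then show ?thesis using that[of 0] c by simp
next
  case False
  then have X: "0 < X" using X by simp
  define T where "T = tanh X * ((s - 1)/(s + 1))"
  have tX: "0 < tanh X" "tanh X < 1" using X by (auto simp: tanh_real_lt_1)
  have "T \<le> tanh X * 1" unfolding T_def using s tX by (intro mult_left_mono) auto
  then have "T < 1" using tX by linarith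
  moreover have "0 \<le> T" using tX s by (simp add: T_def)
  ultimately have T: "0 \<le> T" "T < 1" by auto
  define Y where "Y = artanh T"
  have eY: "exp (- 2 * Y) = (1 - T) / (1 + T)"
    unfolding Y_def artanh_def using T by (simp add: exp_minus field_simps)
  have tY: "tanh Y = T" unfolding tanh_real_altdef eY using T by (simp add: field_simps)
  have Y: "0 \<le> Y" using tY T by (metis tanh_real_nonneg_iff)
  have rel: "tanh Y * (s + 1) = tanh X * (s - 1)" unfolding tY T_def using s by simp
  have "c\<^sup>2 + (sinh (c * Y))\<^sup>2 \<le> c\<^sup>2 + (c * sinh Y)\<^sup>2"
    using sinh_scaled_le[of c Y] c Y by (intro add_left_mono power_mono) auto
  also have "\<dots> = (c * cosh Y)\<^sup>2" by (simp add: cosh_square_eq power_mult_distrib algebra_simps)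
  finally have "sqrt (c\<^sup>2 + (sinh (c * Y))\<^sup>2) \<le> c * cosh Y"
    using c by (intro real_le_lsqrt) auto
  moreover have "s/2 * cosh (X + c * (X - Y)) + 1/(2 * s) * cosh (X + c * (X + Y)) + c * cosh Y
     \<le> (s/2 + 1/(2 * s) + c) * cosh X * (cosh X / cosh Y) powr c"
    using hyperbolic_interpolation[OF s X Y rel c] .
  moreover have "X + c * (X - Y) = (1 + c) * X - c * Y" "X + c * (X + Y) = (1 + c) * X + c * Y"
    by (auto simp: algebra_simps)
  ultimately show ?thesis by (intro that[of Y]) simp
qed

section \<open>Hoelder's inequality and duality for finite sums\<close>

lemma holder_sum:
  fixes a b :: "'i \<Rightarrow> real"
  assumes "finite S" and p: "1 < p" "1 < q" "1/p + 1/q = 1"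
    and nn: "\<And>i. i \<in> S \<Longrightarrow> 0 \<le> a i" "\<And>i. i \<in> S \<Longrightarrow> 0 \<le> b i"
  shows "(\<Sum>i\<in>S. a i * b i) \<le> (\<Sum>i\<in>S. a i powr p) powr (1/p) * (\<Sum>i\<in>S. b i powr q) powr (1/q)"
proof -
  define A where "A = (\<Sum>i\<in>S. a i powr p)"
  define B where "B = (\<Sum>i\<in>S. b i powr q)"
  have AB: "0 \<le> A" "0 \<le> B" by (auto simp: A_def B_def intro!: sum_nonneg)
  show ?thesis
  proof (cases "A = 0 \<or> B = 0")
    case True
    then have "\<forall>i\<in>S. a i * b i = 0"
      using \<open>finite S\<close> by (auto simp: A_def B_def sum_nonneg_eq_0_iff)
    then have "(\<Sum>i\<in>S. a i * b i) = 0" by (intro sum.neutral) auto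
    then show ?thesis by simp
  next
    case False
    then have pos: "0 < A" "0 < B" using AB by auto
    have "a i * b i \<le> A powr (1/p) * B powr (1/q) * (a i powr p / (p * A) + b i powr q / (q * B))"
      if "i \<in> S" for i
    proof -
      have "a i / A powr (1/p) * (b i / B powr (1/q))
          \<le> (a i / A powr (1/p)) powr p / p + (b i / B powr (1/q)) powr q / q"
        using p nn that pos by (intro Youngs_inequality) auto
      also have "\<dots> = a i powr p / (p * A) + b i powr q / (q * B)"
        using p nn that pos by (simp add: powr_divide powr_powr mult.commute)
      finally show ?thesis using pos by (simp add: field_simps)
    qed
    then have "(\<Sum>i\<in>S. a i * b i)
        \<le> (\<Sum>i\<in>S. A powr (1/p) * B powr (1/q) * (a i powr p / (p * A) + b i powr q / (q * B)))"
      by (intro sum_mono) auto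
    also have "\<dots> = A powr (1/p) * B powr (1/q) * (A / (p * A) + B / (q * B))"
      unfolding sum_distrib_left[symmetric] sum.distrib sum_divide_distrib[symmetric]
      by (simp add: A_def[symmetric] B_def[symmetric])
    also have "A / (p * A) + B / (q * B) = 1" using pos p by simp
    finally show ?thesis by (simp add: A_def B_def)
  qed
qed

definition lp_norm :: "'i set \<Rightarrow> real \<Rightarrow> ('i \<Rightarrow> complex) \<Rightarrow> real" where
  "lp_norm S p f = (\<Sum>i\<in>S. cmod (f i) powr p) powr (1 / p)"

lemma lp_norm_nonneg: "0 \<le> lp_norm S p f"
  by (simp add: lp_norm_def)

lemma lp_norm_powr: "0 < p \<Longrightarrow> lp_norm S p f powr p = (\<Sum>i\<in>S. cmod (f i) powr p)"
  by (simp add: lp_norm_def powr_powr sum_nonneg)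

lemma holder_pairing:
  assumes "finite S" "1 < p" "1 < q" "1/p + 1/q = 1"
  shows "cmod (\<Sum>i\<in>S. f i * g i) \<le> lp_norm S p f * lp_norm S q g"
proof -
  have "cmod (\<Sum>i\<in>S. f i * g i) \<le> (\<Sum>i\<in>S. cmod (f i) * cmod (g i))"
    by (rule norm_sum[THEN order_trans]) (simp add: norm_mult)
  also have "\<dots> \<le> lp_norm S p f * lp_norm S q g"
    unfolding lp_norm_def by (rule holder_sum) (use assms in auto)
  finally show ?thesis .
qed

text \<open>
  The extremal functional \<open>g = cnj f * \<bar>f\<bar> powr (p - 2)\<close> turns a bound on all pairings into a bound on
  the norm. This is how norm estimates become estimates of scalar holomorphic functions below.
\<close>

lemma lp_norm_le_by_duality:
  assumes "0 \<le> K" and pq: "1 < p" "1 < q" "1/p + 1/q = 1"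
    and bound: "\<And>g. cmod (\<Sum>i\<in>S. f i * g i) \<le> K * lp_norm S q g"
  shows "lp_norm S p f \<le> K"
proof -
  define g where "g = (\<lambda>i. cnj (f i) * of_real (cmod (f i) powr (p - 2)))"
  define A where "A = (\<Sum>i\<in>S. cmod (f i) powr p)"
  have A0: "0 \<le> A" by (simp add: A_def sum_nonneg)
  have fg: "f i * g i = of_real (cmod (f i) powr p)" for i
  proof (cases "f i = 0")
    case False
    have "f i * g i = of_real ((cmod (f i))\<^sup>2 * cmod (f i) powr (p - 2))"
      unfolding g_def using complex_norm_square[of "f i"] by simp
    also have "(cmod (f i))\<^sup>2 * cmod (f i) powr (p - 2) = cmod (f i) powr p"
      using False by (simp add: powr_diff)
    finally show ?thesis .
  qed (simp add: g_def)
  have gq: "cmod (g i) powr q = cmod (f i) powr p" for i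
  proof (cases "f i = 0")
    case False
    have "cmod (g i) = cmod (f i) powr 1 * cmod (f i) powr (p - 2)"
      using False by (simp add: g_def norm_mult)
    also have "\<dots> = cmod (f i) powr (p - 1)" by (simp only: powr_add[symmetric]) simp
    finally have "cmod (g i) powr q = cmod (f i) powr ((p - 1) * q)" by (simp add: powr_powr)
    also have "(p - 1) * q = p" using pq by (simp add: field_simps)
    finally show ?thesis .
  qed (use pq in \<open>simp add: g_def\<close>)
  have "A \<le> K * A powr (1/q)"
  proof -
    have "(\<Sum>i\<in>S. f i * g i) = of_real A" by (simp add: fg A_def)
    then show ?thesis using bound[of g] A0
      unfolding lp_norm_def gq A_def[symmetric] by simp
  qed
  show ?thesis
  proof (cases "A = 0")
    case True
    then show ?thesis using \<open>0 \<le> K\<close> by (simp add: lp_norm_def A_def[symmetric])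
  next
    case False
    then have A: "0 < A" using A0 by simp
    have "A powr (1/p) * A powr (1/q) \<le> K * A powr (1/q)"
      using \<open>A \<le> K * A powr (1/q)\<close> pq A by (simp add: powr_add[symmetric])
    then show ?thesis using A by (simp add: lp_norm_def A_def[symmetric])
  qed
qed

section \<open>Weissler's two-point inequality\<close>

text \<open>
  The function \<open>(P powr q + Q powr q) powr (1/q)\<close> is concave for \<open>q < 1\<close> and hence the minimum of its
  tangent functionals; \<open>Y\<close> parametrises these. A bound linear in \<open>P\<close> and \<open>Q\<close> makes it easy to maximise
  over the relative phase of \<open>x\<close> and \<open>y\<close> in the two-point inequality.
\<close>

lemma tangent_holder:
  fixes P Q Y c q :: real
  assumes "0 \<le> P" "0 \<le> Q" "0 < q" "q < 1" and c: "c * q = 1 - q"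
  shows "P powr q + Q powr q \<le> (2 * cosh Y) powr (1 - q) * (exp (- c * Y) * P + exp (c * Y) * Q) powr q"
proof -
  define a where "a = (\<lambda>b. if b then (exp (- c * Y) * P) powr q else (exp (c * Y) * Q) powr q)"
  define d where "d = (\<lambda>b. if b then exp ((1 - q) * Y) else exp (- (1 - q) * Y))"
  have "(\<Sum>b\<in>UNIV. a b * d b) \<le> (\<Sum>b\<in>UNIV. a b powr (1/q)) powr (1/(1/q))
     * (\<Sum>b\<in>UNIV. d b powr (1/(1-q))) powr (1/(1/(1-q)))"
    by (rule holder_sum) (use assms in \<open>auto simp: a_def d_def field_simps\<close>)
  moreover have "(\<Sum>b\<in>UNIV. a b * d b) = P powr q + Q powr q"
  proof -
    have "(exp (- c * Y) * P) powr q * exp ((1 - q) * Y) = P powr q" 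
      "(exp (c * Y) * Q) powr q * exp (- (1 - q) * Y) = Q powr q" 
      using assms unfolding c[symmetric]
      by (auto simp: powr_mult exp_powr_real mult_ac simp flip: exp_add)
    then show ?thesis by (simp add: a_def d_def UNIV_bool)
  qed
  moreover have "(\<Sum>b\<in>UNIV. a b powr (1/q)) = exp (- c * Y) * P + exp (c * Y) * Q"
    using assms by (simp add: a_def UNIV_bool powr_powr)
  moreover have "(\<Sum>b\<in>UNIV. d b powr (1/(1-q))) = 2 * cosh Y"
  proof -
    have "(q - 1) * Y / (1 - q) = - Y" using assms by (simp add: divide_eq_eq algebra_simps)
    then show ?thesis using assms by (simp add: d_def UNIV_bool exp_powr_real cosh_def)
  qed
  ultimately show ?thesis by (simp add: mult.commute)
qed

text \<open>
  Up to a common factor, \<open>\<bar>x\<bar>\<^sup>2\<close> and \<open>\<bar>y\<bar>\<^sup>2\<close> are \<open>exp ((1 + c) * X)\<close> and \<open>exp (- (1 + c) * X)\<close>. After the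
  tangent inequality has made the left-hand side linear, the phase of \<open>x * cnj y\<close> enters through one
  real part, whose maximum produces the term \<open>sqrt (c\<^sup>2 + (sinh (c * Y))\<^sup>2)\<close>; what is left is the
  hyperbolic key inequality.
\<close>

lemma two_point_ordered:
  fixes x y u :: complex and c p :: real
  assumes c: "0 < c" "c < 1" and p: "p * (1 + c) = 2"
    and u: "Re u = c * cmod u" "1 \<le> cmod u" and xy: "y \<noteq> 0" "cmod y \<le> cmod x"
  shows "cmod (u * x + y) powr p + cmod (x + u * y) powr p
     \<le> cmod (1 + u) powr p * (cmod x powr p + cmod y powr p)"
proof -
  define s where "s = cmod u"
  define q where "q = p / 2"
  define r where "r = cmod x * cmod y"
  define X where "X = ln (cmod x / cmod y) / (1 + c)"
  have x0: "0 < cmod x" "0 < cmod y" using xy by auto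
  have r: "0 < r" using x0 by (simp add: r_def)
  have s: "1 \<le> s" using u by (simp add: s_def)
  have q: "0 < q" "q < 1" "c * q = 1 - q" 
    using p c unfolding q_def by (auto simp: field_simps) (smt (verit) mult_less_cancel_left2 mult_nonneg_nonneg mult_nonneg_nonpos)+
  have X: "0 \<le> X" using xy x0 c by (auto simp: X_def)
  have eX: "exp ((1 + c) * X) = cmod x / cmod y" using x0 c by (simp add: X_def)
  have xx: "(cmod x)\<^sup>2 = r * exp ((1 + c) * X)" "(cmod y)\<^sup>2 = r * exp (- ((1 + c) * X))"
    unfolding exp_minus eX r_def using x0 by (auto simp: power2_eq_square)
  obtain Y where Y: "s/2 * cosh ((1 + c) * X - c * Y) + 1/(2 * s) * cosh ((1 + c) * X + c * Y)
        + sqrt (c\<^sup>2 + (sinh (c * Y))\<^sup>2)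
     \<le> (s/2 + 1/(2 * s) + c) * cosh X * (cosh X / cosh Y) powr c" 
    using hyperbolic_key_inequality[OF c s X] by blast
  define P where "P = (cmod (u * x + y))\<^sup>2"
  define Q where "Q = (cmod (x + u * y))\<^sup>2"
  define z where "z = x * cnj y"
  have cz: "cmod z = r" by (simp add: z_def r_def norm_mult)
  have PQ: "P = s\<^sup>2 * (cmod x)\<^sup>2 + (cmod y)\<^sup>2 + 2 * Re (z * u)"
     "Q = (cmod x)\<^sup>2 + s\<^sup>2 * (cmod y)\<^sup>2 + 2 * Re (z * cnj u)"
    unfolding P_def Q_def z_def s_def cmod_power2 by (simp_all add: power2_eq_square algebra_simps)
  \<comment> \<open>\<open>z\<close> alone carries the relative phase of \<open>x\<close> and \<open>y\<close>; the weighted sum depends on it through \<open>Re (z * v)\<close>.\<close>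
  define v where "v = of_real (exp (- c * Y)) * u + of_real (exp (c * Y)) * cnj u"
  have "(cmod v)\<^sup>2 = (2 * s)\<^sup>2 * (c\<^sup>2 + (sinh (c * Y))\<^sup>2)"
  proof -
    have "Re v = 2 * Re u * cosh (c * Y)" "Im v = - 2 * Im u * sinh (c * Y)"
      by (auto simp: v_def cosh_def sinh_def field_simps)
    moreover have "(Im u)\<^sup>2 = s\<^sup>2 - (c * s)\<^sup>2" using cmod_power2[of u] u by (simp add: s_def)
    moreover have "Re u = c * s" using u by (simp add: s_def)
    ultimately have "(cmod v)\<^sup>2 = 4 * (c * s)\<^sup>2 * ((sinh (c * Y))\<^sup>2 + 1)
        + 4 * (s\<^sup>2 - (c * s)\<^sup>2) * (sinh (c * Y))\<^sup>2"
      unfolding cmod_power2[of v] cosh_square_eq[symmetric] by (simp add: power_mult_distrib)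
    then show ?thesis by (simp add: power_mult_distrib algebra_simps)
  qed
  then have cv: "cmod v = 2 * s * sqrt (c\<^sup>2 + (sinh (c * Y))\<^sup>2)"
    using s by (metis norm_ge_zero real_sqrt_unique real_sqrt_mult real_sqrt_power power2_eq_square 
        abs_of_nonneg mult_nonneg_nonneg zero_le_numeral order_trans zero_le_one real_sqrt_abs2)
  have K: "(cmod (1 + u))\<^sup>2 = 2 * s * (s/2 + 1/(2 * s) + c)"
  proof -
    have "(cmod (1 + u))\<^sup>2 = 1 + 2 * Re u + ((Re u)\<^sup>2 + (Im u)\<^sup>2)"
      unfolding cmod_power2 by (simp add: power2_eq_square algebra_simps)
    also have "(Re u)\<^sup>2 + (Im u)\<^sup>2 = s\<^sup>2" by (simp add: s_def cmod_power2)
    finally show ?thesis using s u by (simp add: s_def[symmetric] field_simps power2_eq_square)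
  qed
  have "exp (- c * Y) * P + exp (c * Y) * Q = exp (- c * Y) * (s\<^sup>2 * (cmod x)\<^sup>2 + (cmod y)\<^sup>2)
      + exp (c * Y) * ((cmod x)\<^sup>2 + s\<^sup>2 * (cmod y)\<^sup>2) + 2 * Re (z * v)"
    unfolding PQ v_def by (simp add: algebra_simps)
  also have "Re (z * v) \<le> r * cmod v"
    using complex_Re_le_cmod[of "z * v"] by (simp add: norm_mult cz)
  also have "exp (- c * Y) * (s\<^sup>2 * (cmod x)\<^sup>2 + (cmod y)\<^sup>2)
      + exp (c * Y) * ((cmod x)\<^sup>2 + s\<^sup>2 * (cmod y)\<^sup>2)
    = 2 * r * s * (s * cosh ((1 + c) * X - c * Y) + 1/s * cosh ((1 + c) * X + c * Y))"
  proof -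
    define e1 where "e1 = exp ((1 + c) * X)"
    define e2 where "e2 = exp (c * Y)"
    have "0 < e1" "0 < e2" by (auto simp: e1_def e2_def)
    then show ?thesis using s unfolding xx cosh_def
      by (simp add: exp_diff exp_add exp_minus e1_def[symmetric] e2_def[symmetric] field_simps power2_eq_square)
  qed
  finally have "exp (- c * Y) * P + exp (c * Y) * Q
    \<le> 4 * r * s * (s/2 * cosh ((1 + c) * X - c * Y) + 1/(2 * s) * cosh ((1 + c) * X + c * Y)
        + sqrt (c\<^sup>2 + (sinh (c * Y))\<^sup>2))"
    unfolding cv using s by (simp add: field_simps)
  also have "\<dots> \<le> 4 * r * s * ((s/2 + 1/(2 * s) + c) * cosh X * (cosh X / cosh Y) powr c)"
    using Y r s by (intro mult_left_mono) auto
  also have "\<dots> = 2 * r * (cmod (1 + u))\<^sup>2 * (cosh X * (cosh X / cosh Y) powr c)"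
    unfolding K by simp
  finally have main: "exp (- c * Y) * P + exp (c * Y) * Q
    \<le> 2 * r * (cmod (1 + u))\<^sup>2 * (cosh X * (cosh X / cosh Y) powr c)" .
  have powr_half: "t powr p = (t\<^sup>2) powr q" if "0 \<le> t" for t :: real
    using that by (cases "t = 0") (auto simp: q_def powr_powr simp flip: powr_numeral)
  have "cmod (u * x + y) powr p + cmod (x + u * y) powr p = P powr q + Q powr q"
    by (simp add: powr_half P_def Q_def)
  also have "\<dots> \<le> (2 * cosh Y) powr (1 - q) * (exp (- c * Y) * P + exp (c * Y) * Q) powr q"
    using q by (intro tangent_holder) (auto simp: P_def Q_def)
  also have "\<dots> \<le> (2 * cosh Y) powr (1 - q)
     * (2 * r * (cmod (1 + u))\<^sup>2 * (cosh X * (cosh X / cosh Y) powr c)) powr q"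
    using main q by (intro mult_left_mono powr_mono2) (auto simp: P_def Q_def)
  also have "\<dots> = cmod (1 + u) powr p * (r powr q * (2 * cosh X))"
  proof -
    have "(2 * cosh Y) powr (1 - q) * (2 powr q * (cosh X powr q * ((cosh X / cosh Y) powr c) powr q))
       = 2 * cosh X"
    proof -
      have "2 powr (1 - q) * 2 powr q = (2::real)" by (simp add: powr_add[symmetric])
      moreover have "cosh X powr q * cosh X powr (1 - q) = cosh X" by (simp add: powr_add[symmetric])
      moreover have "((cosh X / cosh Y) powr c) powr q = cosh X powr (1 - q) / cosh Y powr (1 - q)"
        using q by (simp add: powr_powr powr_divide)
      ultimately show ?thesis by (simp add: powr_mult)
    qed
    then show ?thesis using r by (simp add: powr_mult powr_half mult_ac)
  qed
  also have "r powr q * (2 * cosh X) = cmod x powr p + cmod y powr p"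
  proof -
    have "(1 + c) * q = 1" using q by (simp add: algebra_simps)
    then have "exp ((1 + c) * X) powr q = exp X" "exp (- ((1 + c) * X)) powr q = exp (- X)"
      by (auto simp: exp_powr_real)
    then show ?thesis using r unfolding powr_half[OF norm_ge_zero] xx
      by (simp add: powr_mult cosh_def algebra_simps)
  qed
  finally show ?thesis by simp
qed

text \<open>
  Replacing \<open>u\<close> by \<open>1/u\<close>, and exchanging \<open>x\<close> and \<open>y\<close>, are symmetries of the inequality; they reduce it
  to the case \<open>\<bar>u\<bar> \<ge> 1\<close>, \<open>\<bar>x\<bar> \<ge> \<bar>y\<bar>\<close>.
\<close>

lemma two_point_lt2:
  fixes x y u :: complex and p :: real
  assumes p: "1 < p" "p < 2" and u: "u \<noteq> 0" "Re u = (2/p - 1) * cmod u"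
  shows "cmod (u * x + y) powr p + cmod (x + u * y) powr p
     \<le> cmod (1 + u) powr p * (cmod x powr p + cmod y powr p)"
proof -
  define c where "c = 2/p - 1"
  have c: "0 < c" "c < 1" "p * (1 + c) = 2" using p by (auto simp: c_def field_simps)
  have both: "cmod (u * x + y) powr p + cmod (x + u * y) powr p
     \<le> cmod (1 + u) powr p * (cmod x powr p + cmod y powr p)"
    if "Re u = c * cmod u" "1 \<le> cmod u" "x \<noteq> 0" "y \<noteq> 0" for u x y :: complex
  proof (cases "cmod y \<le> cmod x")
    case True
    then show ?thesis using two_point_ordered[OF c that(1,2)] that by blast
  next
    case False
    then show ?thesis using two_point_ordered[OF c that(1,2), of x y] that 
      by (simp add: add.commute)
  qed
  have nz: "cmod (u * x + y) powr p + cmod (x + u * y) powr p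
     \<le> cmod (1 + u) powr p * (cmod x powr p + cmod y powr p)"
    if u: "Re u = c * cmod u" "1 \<le> cmod u" and x: "x \<noteq> 0" for u x y :: complex
  proof (cases "y = 0")
    case True
    \<comment> \<open>The parameter \<open>X\<close> of the hyperbolic inequality is infinite when \<open>y = 0\<close>; pass to the limit.\<close>
    define G where "G = (\<lambda>y. cmod (1 + u) powr p * (cmod x powr p + cmod y powr p)
      - (cmod (u * x + y) powr p + cmod (x + u * y) powr p))"
    have "continuous_on UNIV G" unfolding G_def using p
      by (intro continuous_on_diff continuous_on_add continuous_on_mult continuous_on_powr' continuous_on_norm continuous_intros) auto
    then have "(G \<longlongrightarrow> G 0) (at 0)" by (simp add: continuous_on_def)
    moreover have "eventually (\<lambda>y. 0 \<le> G y) (at 0)"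
      unfolding eventually_at_filter using both[OF u x] by (simp add: G_def)
    ultimately have "0 \<le> G 0" by (rule tendsto_lowerbound) simp
    then show ?thesis using True by (simp add: G_def)
  qed (use both that in blast)
  have large: "cmod (u * x + y) powr p + cmod (x + u * y) powr p
     \<le> cmod (1 + u) powr p * (cmod x powr p + cmod y powr p)"
    if "Re u = c * cmod u" "1 \<le> cmod u" for u x y :: complex
  proof (cases "x = 0")
    case True
    then show ?thesis using nz[OF that, of y 0] by (cases "y = 0") (simp_all add: add.commute)
  qed (use nz that in blast)
  show ?thesis
  proof (cases "1 \<le> cmod u")
    case True
    then show ?thesis using large u by (simp add: c_def)
  next
    case False
    define v where "v = 1 / u"
    have v: "cmod v = 1 / cmod u" by (simp add: v_def norm_divide)
    have "Re v = Re u / (cmod u)\<^sup>2" unfolding v_def by (simp add: Re_divide cmod_power2)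
    then have "Re v = c * cmod v" unfolding v using u by (simp add: c_def power2_eq_square)
    moreover have "1 \<le> cmod v" unfolding v using False u by (simp add: field_simps)
    ultimately have "cmod u powr p * (cmod (v * y + x) powr p + cmod (y + v * x) powr p)
     \<le> cmod u powr p * (cmod (1 + v) powr p * (cmod y powr p + cmod x powr p))"
      by (intro mult_left_mono large) auto
    moreover have "cmod u powr p * cmod z powr p = cmod (u * z) powr p" for z
      by (simp add: norm_mult powr_mult)
    moreover have "u * (v * y + x) = u * x + y" "u * (y + v * x) = x + u * y" "u * (1 + v) = 1 + u"
      using u by (auto simp: v_def algebra_simps)
    ultimately show ?thesis by (simp add: distrib_left mult.assoc[symmetric] add_ac)
  qed
qed

text \<open>
  Weissler's inequality for equal exponents. At \<open>p = 2\<close> the number \<open>u\<close> is imaginary and the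
  parallelogram law gives equality. For \<open>p > 2\<close> the matrix with rows \<open>(u, 1)\<close> and \<open>(1, u)\<close> is
  symmetric, so its norms on \<open>l\<^sub>p\<close> and on the dual \<open>l\<^sub>q\<close> agree, and \<open>\<bar>1 - 2/p\<bar> = \<bar>1 - 2/q\<bar>\<close>.
\<close>

theorem weissler_two_point:
  fixes x y u :: complex and p :: real
  assumes p: "1 < p" and u: "u \<noteq> 0" "Re u = \<bar>1 - 2/p\<bar> * cmod u"
  shows "cmod (u * x + y) powr p + cmod (x + u * y) powr p
     \<le> cmod (1 + u) powr p * (cmod x powr p + cmod y powr p)"
proof -
  consider "p < 2" | "p = 2" | "2 < p" by linarith
  then show ?thesis
  proof cases
    case 1
    then have "\<bar>1 - 2/p\<bar> = 2/p - 1" using p by (simp add: field_simps)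
    then show ?thesis using two_point_lt2[OF p 1, of u x y] u by simp
  next
    case 2
    then have "Re u = 0" using u by simp
    have "cmod (u * x + y) powr 2 + cmod (x + u * y) powr 2
      = cmod (1 + u) powr 2 * (cmod x powr 2 + cmod y powr 2)"
      unfolding powr_numeral[OF norm_ge_zero] cmod_power2
      by (simp add: \<open>Re u = 0\<close> power2_eq_square algebra_simps)
    then show ?thesis using 2 by simp
  next
    case 3
    define q where "q = p / (p - 1)"
    have q: "1 < q" "q < 2" "1/p + 1/q = 1" "2/q - 1 = \<bar>1 - 2/p\<bar>"
      using 3 by (auto simp: q_def field_simps)
    define f where "f = (\<lambda>b. if b then u * x + y else x + u * y)"
    define f0 where "f0 = (\<lambda>b. if b then x else y)"
    have "lp_norm UNIV p f \<le> cmod (1 + u) * lp_norm UNIV p f0"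
    proof (rule lp_norm_le_by_duality[OF _ p q(1,3)])
      show "0 \<le> cmod (1 + u) * lp_norm UNIV p f0" by (simp add: lp_norm_nonneg)
    next
      fix g :: "bool \<Rightarrow> complex"
      define h where "h = (\<lambda>b. if b then u * g True + g False else g True + u * g False)"
      have "(\<Sum>b\<in>UNIV. f b * g b) = (\<Sum>b\<in>UNIV. f0 b * h b)"
        by (simp add: f_def f0_def h_def UNIV_bool algebra_simps)
      then have "cmod (\<Sum>b\<in>UNIV. f b * g b) \<le> lp_norm UNIV p f0 * lp_norm UNIV q h"
        using holder_pairing[of UNIV p q f0 h] p q by simp
      also have "\<dots> \<le> lp_norm UNIV p f0 * (cmod (1 + u) * lp_norm UNIV q g)"
      proof (rule mult_left_mono)
        have "(\<Sum>b\<in>UNIV. cmod (h b) powr q) \<le> cmod (1 + u) powr q * (\<Sum>b\<in>UNIV. cmod (g b) powr q)"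
          using two_point_lt2[OF q(1,2) u(1), of "g True" "g False"] u(2) q(4)
          by (simp add: h_def UNIV_bool add.commute)
        then have "lp_norm UNIV q h \<le> (cmod (1 + u) powr q * (\<Sum>b\<in>UNIV. cmod (g b) powr q)) powr (1/q)"
          unfolding lp_norm_def using q by (intro powr_mono2) (auto intro!: sum_nonneg)
        also have "\<dots> = cmod (1 + u) * lp_norm UNIV q g"
          using q by (simp add: lp_norm_def powr_mult powr_powr sum_nonneg)
        finally show "lp_norm UNIV q h \<le> cmod (1 + u) * lp_norm UNIV q g" .
      qed (simp add: lp_norm_nonneg)
      finally show "cmod (\<Sum>b\<in>UNIV. f b * g b) \<le> cmod (1 + u) * lp_norm UNIV p f0 * lp_norm UNIV q g"
        by (simp add: mult_ac)
    qed
    then have "lp_norm UNIV p f powr p \<le> (cmod (1 + u) * lp_norm UNIV p f0) powr p"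
      using p by (intro powr_mono2) (auto simp: lp_norm_nonneg)
    then show ?thesis using p
      by (simp add: powr_mult lp_norm_nonneg lp_norm_powr f_def f0_def UNIV_bool add.commute)
  qed
qed

text \<open>
  The two circular arcs from \<open>-1\<close> to \<open>1\<close> that are the images of the rays at angles \<open>\<plusminus> arccos \<kappa>\<close>
  under the Cayley transform. They meet in corners at the two ends; for \<open>\<kappa> = 0\<close> they form the unit circle.
\<close>

definition lens_boundary :: "real \<Rightarrow> complex set" where
  "lens_boundary \<kappa> = {1, -1} \<union> {(u - 1) / (u + 1) |u. u \<noteq> 0 \<and> Re u = \<kappa> * cmod u}"

lemma two_point_contraction:
  fixes x y w :: complex and p :: real
  assumes p: "1 < p" and w: "w \<in> lens_boundary \<bar>1 - 2/p\<bar>"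
  shows "cmod ((1 + w)/2 * x + (1 - w)/2 * y) powr p + cmod ((1 - w)/2 * x + (1 + w)/2 * y) powr p
     \<le> cmod x powr p + cmod y powr p"
proof -
  consider "w = 1" | "w = -1" | u where "u \<noteq> 0" "Re u = \<bar>1 - 2/p\<bar> * cmod u" "w = (u - 1) / (u + 1)"
    using w by (auto simp: lens_boundary_def)
  then show ?thesis
  proof cases
    case 3
    have u1: "1 + u \<noteq> 0"
    proof
      assume "1 + u = 0"
      then have "u = -1" by (simp add: add_eq_0_iff)
      then show False using 3 by simp
    qed
    have "w * (1 + u) = u - 1" unfolding 3 using u1 by (simp add: add.commute)
    then have w': "(1 + w)/2 = u / (1 + u)" "(1 - w)/2 = 1 / (1 + u)"
      using u1 by (simp_all add: eq_divide_eq algebra_simps)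
    have "cmod ((1 + w)/2 * x + (1 - w)/2 * y) = cmod (u * x + y) / cmod (1 + u)"
      "cmod ((1 - w)/2 * x + (1 + w)/2 * y) = cmod (x + u * y) / cmod (1 + u)"
      unfolding w' norm_divide[symmetric] by (simp_all add: add_divide_distrib)
    then show ?thesis using weissler_two_point[OF p 3(1,2), of x y] u1
      by (simp only: powr_divide norm_ge_zero add_divide_distrib[symmetric])
        (simp add: divide_le_eq mult.commute)
  qed auto
qed

section \<open>Noise operators on the cube\<close>

text \<open>
  The heat semigroup at the complex time \<open>t\<close> with \<open>w = exp (- t)\<close>; also \<open>w = 0\<close> is included.
\<close>

definition noise :: "nat \<Rightarrow> complex \<Rightarrow> ((nat \<Rightarrow> real) \<Rightarrow> complex) \<Rightarrow> (nat \<Rightarrow> real) \<Rightarrow> complex" where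
  "noise n w f \<epsilon> = (\<Sum>A\<in>Pow {1..n}. w ^ card A * walsh_coeff n f A * of_real (walsh A \<epsilon>))"

lemma finite_cube [simp]: "finite (cube n)"
  by (simp add: cube_def finite_PiE)

lemma cube_val: "\<epsilon> \<in> cube n \<Longrightarrow> i \<in> {1..n} \<Longrightarrow> \<epsilon> i = 1 \<or> \<epsilon> i = -1"
  by (auto simp: cube_def PiE_iff)

lemma sum_walsh_walsh:
  assumes "\<epsilon> \<in> cube n" "\<delta> \<in> cube n"
  shows "(\<Sum>A\<in>Pow {1..n}. walsh A \<epsilon> * walsh A \<delta>) = (if \<epsilon> = \<delta> then 2 ^ n else 0)"
proof -
  have "(\<Sum>A\<in>Pow {1..n}. walsh A \<epsilon> * walsh A \<delta>) = (\<Prod>i\<in>{1..n}. \<epsilon> i * \<delta> i + 1)"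
    by (simp add: prod_add walsh_def prod.distrib)
  also have "\<dots> = (if \<epsilon> = \<delta> then 2 ^ n else 0)"
  proof (cases "\<epsilon> = \<delta>")
    case True
    have "\<epsilon> i * \<epsilon> i + 1 = 2" if "i \<in> {1..n}" for i using cube_val[OF assms(1) that] by auto
    then show ?thesis using True by simp
  next
    case False
    then obtain i where i: "i \<in> {1..n}" "\<epsilon> i \<noteq> \<delta> i"
      using assms unfolding cube_def by (metis PiE_ext)
    then have "\<epsilon> i * \<delta> i + 1 = 0"
      using cube_val[OF assms(1) i(1)] cube_val[OF assms(2) i(1)] by auto
    then show ?thesis using False i by (auto intro!: prod_zero bexI[of _ i])
  qed
  finally show ?thesis .
qed

definition flip :: "nat \<Rightarrow> (nat \<Rightarrow> real) \<Rightarrow> nat \<Rightarrow> real" where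
  "flip i \<epsilon> = \<epsilon>(i := - \<epsilon> i)"

lemma flip_cube: "i \<in> {1..n} \<Longrightarrow> \<epsilon> \<in> cube n \<Longrightarrow> flip i \<epsilon> \<in> cube n"
  by (auto simp: cube_def flip_def PiE_iff extensional_def)

lemma sum_cube_flip: "i \<in> {1..n} \<Longrightarrow> (\<Sum>\<epsilon>\<in>cube n. h (flip i \<epsilon>)) = (\<Sum>\<epsilon>\<in>cube n. h \<epsilon>)"
  by (rule sum.reindex_bij_witness[of _ "flip i" "flip i"]) (auto simp: flip_cube, auto simp: flip_def)

lemma walsh_flip: "finite A \<Longrightarrow> walsh A (flip i \<epsilon>) = (if i \<in> A then - walsh A \<epsilon> else walsh A \<epsilon>)"
proof -
  assume A: "finite A"
  show ?thesis
  proof (cases "i \<in> A")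
    case True
    have "prod (flip i \<epsilon>) (A - {i}) = prod \<epsilon> (A - {i})"
      by (intro prod.cong) (auto simp: flip_def)
    then show ?thesis using A True unfolding walsh_def
      by (simp add: prod.remove[of A i] flip_def)
  next
    case False
    then show ?thesis unfolding walsh_def flip_def by (auto intro!: prod.cong)
  qed
qed

lemma sum_cube_walsh:
  assumes "A \<subseteq> {1..n}"
  shows "(\<Sum>\<epsilon>\<in>cube n. walsh A \<epsilon>) = (if A = {} then 2 ^ n else 0)"
proof (cases "A = {}")
  case True
  then show ?thesis by (simp add: walsh_def cube_def card_PiE numeral_2_eq_2)
next
  case False
  then obtain i where i: "i \<in> A" by blast
  then have "(\<Sum>\<epsilon>\<in>cube n. walsh A \<epsilon>) = - (\<Sum>\<epsilon>\<in>cube n. walsh A \<epsilon>)"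
    using sum_cube_flip[of i n "walsh A"] assms
    by (simp add: walsh_flip finite_subset[OF assms] subset_iff sum_negf)
  then show ?thesis using False by simp
qed

lemma walsh_mult:
  assumes "\<epsilon> \<in> cube n" "A \<subseteq> {1..n}" "B \<subseteq> {1..n}"
  shows "walsh A \<epsilon> * walsh B \<epsilon> = walsh (A - B \<union> (B - A)) \<epsilon>"
proof -
  have fin: "finite A" "finite B" using assms finite_subset by auto
  have sq: "walsh (A \<inter> B) \<epsilon> * walsh (A \<inter> B) \<epsilon> = 1"
    unfolding walsh_def prod.distrib[symmetric] using cube_val[OF assms(1)] assms
    by (intro prod.neutral) force
  have "walsh A \<epsilon> = walsh (A - B) \<epsilon> * walsh (A \<inter> B) \<epsilon>"
    unfolding walsh_def using fin by (subst prod.union_disjoint[symmetric]) (auto intro!: prod.cong)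
  moreover have "walsh B \<epsilon> = walsh (B - A) \<epsilon> * walsh (A \<inter> B) \<epsilon>"
    unfolding walsh_def using fin by (subst prod.union_disjoint[symmetric]) (auto intro!: prod.cong)
  moreover have "walsh (A - B \<union> (B - A)) \<epsilon> = walsh (A - B) \<epsilon> * walsh (B - A) \<epsilon>"
    unfolding walsh_def using fin by (subst prod.union_disjoint) auto
  ultimately show ?thesis using sq by (simp add: mult_ac)
qed

lemma sum_cube_walsh_mult:
  assumes "A \<subseteq> {1..n}" "B \<subseteq> {1..n}"
  shows "(\<Sum>\<epsilon>\<in>cube n. walsh A \<epsilon> * walsh B \<epsilon>) = (if A = B then 2 ^ n else 0)"
proof -
  have "(\<Sum>\<epsilon>\<in>cube n. walsh A \<epsilon> * walsh B \<epsilon>) = (\<Sum>\<epsilon>\<in>cube n. walsh (A - B \<union> (B - A)) \<epsilon>)"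
    using assms by (intro sum.cong) (auto simp: walsh_mult)
  also have "\<dots> = (if A = B then 2 ^ n else 0)"
    using assms by (subst sum_cube_walsh) auto
  finally show ?thesis .
qed

lemma noise_one:
  assumes "\<epsilon> \<in> cube n"
  shows "noise n 1 f \<epsilon> = f \<epsilon>"
proof -
  have "noise n 1 f \<epsilon> = (\<Sum>A\<in>Pow {1..n}. \<Sum>\<delta>\<in>cube n. f \<delta> * of_real (walsh A \<epsilon> * walsh A \<delta>) / 2 ^ n)"
    unfolding noise_def walsh_coeff_def sum_divide_distrib sum_distrib_right sum_distrib_left
    by (intro sum.cong refl) simp
  also have "\<dots> = (\<Sum>\<delta>\<in>cube n. \<Sum>A\<in>Pow {1..n}. f \<delta> * of_real (walsh A \<epsilon> * walsh A \<delta>) / 2 ^ n)"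
    by (rule sum.swap)
  also have "\<dots> = (\<Sum>\<delta>\<in>cube n. f \<delta> * of_real (\<Sum>A\<in>Pow {1..n}. walsh A \<epsilon> * walsh A \<delta>) / 2 ^ n)"
    by (simp add: sum_distrib_left sum_divide_distrib)
  also have "\<dots> = (\<Sum>\<delta>\<in>cube n. if \<delta> = \<epsilon> then f \<delta> else 0)"
    by (intro sum.cong refl, simp only: sum_walsh_walsh[OF assms]) auto
  also have "\<dots> = f \<epsilon>" using assms by simp
  finally show ?thesis .
qed

lemma walsh_coeff_noise:
  assumes B: "B \<subseteq> {1..n}"
  shows "walsh_coeff n (noise n w f) B = w ^ card B * walsh_coeff n f B"
proof -
  have "(\<Sum>\<delta>\<in>cube n. noise n w f \<delta> * of_real (walsh B \<delta>))
    = (\<Sum>\<delta>\<in>cube n. \<Sum>A\<in>Pow {1..n}. w ^ card A * walsh_coeff n f A * of_real (walsh A \<delta> * walsh B \<delta>))"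
    unfolding noise_def sum_distrib_right by (intro sum.cong refl) simp
  also have "\<dots> = (\<Sum>A\<in>Pow {1..n}. \<Sum>\<delta>\<in>cube n. w ^ card A * walsh_coeff n f A * of_real (walsh A \<delta> * walsh B \<delta>))"
    by (rule sum.swap)
  also have "\<dots> = (\<Sum>A\<in>Pow {1..n}. w ^ card A * walsh_coeff n f A * of_real (\<Sum>\<delta>\<in>cube n. walsh A \<delta> * walsh B \<delta>))"
    by (simp add: sum_distrib_left)
  also have "\<dots> = (\<Sum>A\<in>Pow {1..n}. if A = B then w ^ card A * walsh_coeff n f A * 2 ^ n else 0)"
    using B by (intro sum.cong refl) (auto simp: sum_cube_walsh_mult)
  also have "\<dots> = w ^ card B * walsh_coeff n f B * 2 ^ n"
    using B by (simp add: sum.delta)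
  finally show ?thesis by (simp add: walsh_coeff_def)
qed

lemma noise_noise: "noise n w (noise n v f) \<epsilon> = noise n (w * v) f \<epsilon>"
  unfolding noise_def[of n w] noise_def[of n "w * v"]
  by (intro sum.cong refl) (auto simp: walsh_coeff_noise power_mult_distrib)

lemma noise_pairing:
  "(\<Sum>\<epsilon>\<in>cube n. noise n w f \<epsilon> * g \<epsilon>)
    = (\<Sum>A\<in>Pow {1..n}. (2 ^ n * walsh_coeff n f A * walsh_coeff n g A) * w ^ card A)"
proof -
  have "(\<Sum>\<epsilon>\<in>cube n. noise n w f \<epsilon> * g \<epsilon>)
    = (\<Sum>\<epsilon>\<in>cube n. \<Sum>A\<in>Pow {1..n}. w ^ card A * walsh_coeff n f A * (g \<epsilon> * of_real (walsh A \<epsilon>)))"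
    unfolding noise_def sum_distrib_right by (intro sum.cong refl) (simp add: mult_ac)
  also have "\<dots> = (\<Sum>A\<in>Pow {1..n}. \<Sum>\<epsilon>\<in>cube n. w ^ card A * walsh_coeff n f A * (g \<epsilon> * of_real (walsh A \<epsilon>)))"
    by (rule sum.swap)
  also have "\<dots> = (\<Sum>A\<in>Pow {1..n}. (2 ^ n * walsh_coeff n f A * walsh_coeff n g A) * w ^ card A)"
    by (intro sum.cong refl, simp only: sum_distrib_left[symmetric] walsh_coeff_def[of n g]) simp
  finally show ?thesis .
qed

text \<open>
  Averaging over the pairs \<open>\<epsilon>\<close>, \<open>flip i \<epsilon>\<close> reduces the claim to the two-point inequality on each pair.
\<close>

lemma coordinate_contraction:
  assumes p: "1 < p" and w: "w \<in> lens_boundary \<bar>1 - 2/p\<bar>" and i: "i \<in> {1..n}"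
  shows "(\<Sum>\<epsilon>\<in>cube n. cmod ((1 + w)/2 * g \<epsilon> + (1 - w)/2 * g (flip i \<epsilon>)) powr p)
     \<le> (\<Sum>\<epsilon>\<in>cube n. cmod (g \<epsilon>) powr p)"
proof -
  define h where "h = (\<lambda>\<epsilon>. cmod ((1 + w)/2 * g \<epsilon> + (1 - w)/2 * g (flip i \<epsilon>)) powr p)"
  have ff: "flip i (flip i \<epsilon>) = \<epsilon>" for \<epsilon> by (auto simp: flip_def)
  have "2 * (\<Sum>\<epsilon>\<in>cube n. h \<epsilon>) = (\<Sum>\<epsilon>\<in>cube n. h \<epsilon> + h (flip i \<epsilon>))"
    by (simp add: sum.distrib sum_cube_flip[OF i])
  also have "\<dots> \<le> (\<Sum>\<epsilon>\<in>cube n. cmod (g \<epsilon>) powr p + cmod (g (flip i \<epsilon>)) powr p)"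
  proof (rule sum_mono)
    fix \<epsilon>
    show "h \<epsilon> + h (flip i \<epsilon>) \<le> cmod (g \<epsilon>) powr p + cmod (g (flip i \<epsilon>)) powr p"
      using two_point_contraction[OF p w, of "g \<epsilon>" "g (flip i \<epsilon>)"] by (simp add: h_def ff add.commute)
  qed
  also have "\<dots> = 2 * (\<Sum>\<epsilon>\<in>cube n. cmod (g \<epsilon>) powr p)"
    using sum_cube_flip[OF i, of "\<lambda>\<epsilon>. cmod (g \<epsilon>) powr p"] by (simp add: sum.distrib)
  finally show ?thesis by (simp add: h_def)
qed

text \<open>
  Since domain and target exponent agree, the two-point inequality tensorises: the noise operator is
  the product of commuting operators, one per coordinate, and each is a contraction.
\<close>

theorem noise_contraction:
  assumes p: "1 < p" and w: "w \<in> lens_boundary \<bar>1 - 2/p\<bar>"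
  shows "lp_norm (cube n) p (noise n w f) \<le> lp_norm (cube n) p f"
proof -
  \<comment> \<open>noise in the coordinates of \<open>S\<close> only\<close>
  define T where "T = (\<lambda>S \<epsilon>. \<Sum>A\<in>Pow {1..n}. w ^ card (A \<inter> S) * walsh_coeff n f A * of_real (walsh A \<epsilon>))"
  have "(\<Sum>\<epsilon>\<in>cube n. cmod (T S \<epsilon>) powr p) \<le> (\<Sum>\<epsilon>\<in>cube n. cmod (f \<epsilon>) powr p)"
    if "finite S" "S \<subseteq> {1..n}" for S
    using that
  proof (induction S rule: finite_induct)
    case empty
    have "T {} \<epsilon> = f \<epsilon>" if "\<epsilon> \<in> cube n" for \<epsilon>
      using noise_one[OF that, of f] by (simp add: T_def noise_def)
    then show ?case by simp
  next
    case (insert i S)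
    have "T (insert i S) \<epsilon> = (1 + w)/2 * T S \<epsilon> + (1 - w)/2 * T S (flip i \<epsilon>)" for \<epsilon>
      unfolding T_def sum_distrib_left sum.distrib[symmetric]
    proof (intro sum.cong refl)
      fix A assume "A \<in> Pow {1..n}"
      then have "finite A" using finite_subset by auto
      moreover have "card (A \<inter> insert i S) = (if i \<in> A then Suc (card (A \<inter> S)) else card (A \<inter> S))"
        using insert by simp
      ultimately show "w ^ card (A \<inter> insert i S) * walsh_coeff n f A * of_real (walsh A \<epsilon>)
        = (1 + w)/2 * (w ^ card (A \<inter> S) * walsh_coeff n f A * of_real (walsh A \<epsilon>))
        + (1 - w)/2 * (w ^ card (A \<inter> S) * walsh_coeff n f A * of_real (walsh A (flip i \<epsilon>)))"
        by (auto simp: walsh_flip field_simps)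
    qed
    then have "(\<Sum>\<epsilon>\<in>cube n. cmod (T (insert i S) \<epsilon>) powr p) \<le> (\<Sum>\<epsilon>\<in>cube n. cmod (T S \<epsilon>) powr p)"
      using coordinate_contraction[OF p w, of i n "T S"] insert.prems by simp
    then show ?case using insert by simp
  qed
  moreover have "T {1..n} = noise n w f"
    unfolding T_def noise_def by (intro ext sum.cong refl) (simp add: Int_absorb2)
  ultimately have "(\<Sum>\<epsilon>\<in>cube n. cmod (noise n w f \<epsilon>) powr p) \<le> (\<Sum>\<epsilon>\<in>cube n. cmod (f \<epsilon>) powr p)"
    by (metis finite_atLeastAtMost order_refl)
  then show ?thesis unfolding lp_norm_def using p by (intro powr_mono2) (auto intro!: sum_nonneg)
qed

section \<open>Conformal maps of the interior and exterior of a lens\<close>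

text \<open>
  Conjugating with the Cayley transform \<open>z \<mapsto> (1 + z) / (1 - z)\<close>, this is the power map
  \<open>v \<mapsto> v powr \<alpha>\<close>, which takes the right half-plane to a sector of angle \<open>\<alpha> * pi\<close>. For \<open>\<alpha> \<le> 1\<close>
  it is the Riemann map of the disc onto the interior of a lens, fixing \<open>0\<close>; for \<open>1 \<le> \<alpha> < 2\<close> its
  reciprocal maps the disc onto the exterior of a lens, with \<open>0\<close> going to infinity. Numerator and
  denominator carry separate powers, and not the power of the quotient, because in this form the
  map extends continuously to the corners \<open>1\<close> and \<open>-1\<close>.
\<close>

definition disc_to_lens :: "real \<Rightarrow> complex \<Rightarrow> complex" where
  "disc_to_lens \<alpha> z = ((1 + z) powr of_real \<alpha> - (1 - z) powr of_real \<alpha>)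
     / ((1 + z) powr of_real \<alpha> + (1 - z) powr of_real \<alpha>)"

text \<open>
  The principal power of the quotient \<open>v\<close> splits as usual: \<open>v\<close> and \<open>1 - z\<close> have nonnegative and
  positive real part, so the sum of their arguments lies strictly between \<open>-pi\<close> and \<open>pi\<close>.
\<close>

lemma powr_cayley:
  fixes z :: complex and \<alpha> :: real
  assumes "cmod z \<le> 1" "z \<noteq> 1" "z \<noteq> -1"
  defines "v \<equiv> (1 + z) / (1 - z)"
  shows "v \<noteq> 0" "\<bar>Im (Ln v)\<bar> \<le> pi/2" "(1 - z) powr of_real \<alpha> \<noteq> 0"
    and "(1 + z) powr of_real \<alpha> = exp (of_real \<alpha> * Ln v) * (1 - z) powr of_real \<alpha>"
    and "cmod z = 1 \<Longrightarrow> \<bar>Im (Ln v)\<bar> = pi/2"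
proof -
  have nz: "1 - z \<noteq> 0" "1 + z \<noteq> 0" using assms by (auto simp: add_eq_0_iff)
  show v0: "v \<noteq> 0" using nz by (simp add: v_def)
  have Rev: "Re v = (1 - (cmod z)\<^sup>2) / (cmod (1 - z))\<^sup>2"
    unfolding v_def Re_divide cmod_power2 by (simp add: power2_eq_square algebra_simps)
  also have "\<dots> \<ge> 0" using assms by (simp add: power_le_one)
  finally have "0 \<le> Re v" .
  then show Lv: "\<bar>Im (Ln v)\<bar> \<le> pi/2" using Re_Ln_pos_le[OF v0] by simp
  have "Re z < 1"
  proof (rule ccontr)
    assume "\<not> Re z < 1"
    then have "1 \<le> Re z" by simp
    then have "Re z = 1" using assms(1) complex_Re_le_cmod[of z] by linarith
    moreover have "(Re z)\<^sup>2 + (Im z)\<^sup>2 \<le> 1"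
      using assms(1) by (simp add: power_le_one flip: cmod_power2)
    ultimately have "Re z = 1" "Im z = 0" by auto
    then show False using assms by (simp add: complex_eq_iff)
  qed
  then have L1: "\<bar>Im (Ln (1 - z))\<bar> < pi/2" using Re_Ln_pos_lt_imp[of "1 - z"] by simp
  have "1 + z = v * (1 - z)" using nz by (simp add: v_def)
  then have "Ln (1 + z) = Ln (v * (1 - z))" by simp
  also have "\<dots> = Ln v + Ln (1 - z)"
    using Lv L1 nz v0 by (intro Ln_times_simple) auto
  finally show "(1 + z) powr of_real \<alpha> = exp (of_real \<alpha> * Ln v) * (1 - z) powr of_real \<alpha>"
    using nz by (simp add: powr_def exp_add[symmetric] algebra_simps)
  show "(1 - z) powr of_real \<alpha> \<noteq> 0" using nz by simp
  show "\<bar>Im (Ln v)\<bar> = pi/2" if "cmod z = 1"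
  proof -
    have "\<not> \<bar>Im (Ln v)\<bar> < pi/2" unfolding Re_Ln_pos_lt[OF v0] Rev using that by simp
    then show ?thesis using Lv by simp
  qed
qed

text \<open>
  Here \<open>q\<close> is \<open>v powr \<alpha>\<close> for \<open>v = (1 + z) / (1 - z)\<close>. The argument of \<open>v\<close> is at most \<open>pi/2\<close> in modulus, with
  equality on the unit circle; as \<open>\<alpha> < 2\<close>, the argument of \<open>q\<close> stays inside \<open>(-pi, pi)\<close>, which
  excludes \<open>q = -1\<close>.
\<close>

lemma disc_to_lens_cayley:
  fixes z :: complex and \<alpha> :: real
  assumes \<alpha>: "0 < \<alpha>" "\<alpha> < 2" and z: "cmod z \<le> 1" "z \<noteq> 1" "z \<noteq> -1"
  obtains q where "q \<noteq> 0" "q \<noteq> -1" "q = 1 \<Longrightarrow> z = 0" "disc_to_lens \<alpha> z = (q - 1) / (q + 1)"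
    "cmod z = 1 \<Longrightarrow> Re q = cos (\<alpha> * pi / 2) * cmod q"
    "(1 + z) powr of_real \<alpha> + (1 - z) powr of_real \<alpha> \<noteq> 0"
proof -
  define v where "v = (1 + z) / (1 - z)"
  define m where "m = of_real \<alpha> * Ln v"
  define b where "b = (1 - z) powr complex_of_real \<alpha>"
  note pc = powr_cayley[OF z, folded v_def]
  have "\<bar>Im m\<bar> = \<alpha> * \<bar>Im (Ln v)\<bar>" using \<alpha> by (simp add: m_def abs_mult)
  also have "\<dots> \<le> \<alpha> * (pi/2)" using \<alpha> pc(2) by (intro mult_left_mono) auto
  also have "\<dots> < 2 * (pi/2)" using \<alpha> by (intro mult_strict_right_mono) auto
  finally have Im: "\<bar>Im m\<bar> < pi" by simp
  have Ln: "Ln (exp m) = m" using Im by (intro Ln_exp) auto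
  have n1: "exp m \<noteq> -1"
  proof
    assume "exp m = -1"
    then have "m = \<i> * pi" using Ln by simp
    then show False using Im by simp
  qed
  have z0: "z = 0" if "exp m = 1"
  proof -
    have "m = 0" using Ln that by simp
    then have "Ln v = 0" using \<alpha> by (simp add: m_def)
    then have "v = 1" using pc(1) by (metis exp_Ln exp_zero)
    then have "1 + z = 1 - z" using z by (simp add: v_def divide_eq_1_iff)
    then show ?thesis by (simp add: algebra_simps)
  qed
  have a: "(1 + z) powr of_real \<alpha> = exp m * b" using pc(4) by (simp add: m_def b_def)
  have b0: "b \<noteq> 0" using pc(3) by (simp add: b_def)
  have den: "(1 + z) powr of_real \<alpha> + (1 - z) powr of_real \<alpha> = (exp m + 1) * b"
    using a by (simp add: b_def algebra_simps)
  have num: "(1 + z) powr of_real \<alpha> - (1 - z) powr of_real \<alpha> = (exp m - 1) * b"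
    using a by (simp add: b_def algebra_simps)
  show ?thesis
  proof (rule that[of "exp m"])
    show "disc_to_lens \<alpha> z = (exp m - 1) / (exp m + 1)"
      unfolding disc_to_lens_def den num using b0 by simp
    show "(1 + z) powr of_real \<alpha> + (1 - z) powr of_real \<alpha> \<noteq> 0"
      unfolding den using b0 n1 by (simp add: add_eq_0_iff2)
    show "Re (exp m) = cos (\<alpha> * pi / 2) * cmod (exp m)" if "cmod z = 1"
    proof -
      have "\<bar>Im m\<bar> = \<alpha> * pi / 2" using pc(5)[OF that] \<alpha> by (simp add: m_def abs_mult)
      then have "cos (Im m) = cos (\<alpha> * pi / 2)" by (metis cos_abs_real)
      then show ?thesis by (simp add: Re_exp)
    qed
  qed (use n1 z0 in auto)
qed

lemma disc_to_lens_ends: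
  assumes "0 < \<alpha>"
  shows "disc_to_lens \<alpha> 0 = 0" "disc_to_lens \<alpha> 1 = 1" "disc_to_lens \<alpha> (-1) = -1"
  using assms by (auto simp: disc_to_lens_def)

lemma disc_to_lens_denominator:
  assumes "0 < \<alpha>" "\<alpha> < 2" "cmod z \<le> 1"
  shows "(1 + z) powr of_real \<alpha> + (1 - z) powr of_real \<alpha> \<noteq> 0"
proof -
  consider "z = 1" | "z = -1" | "z \<noteq> 1" "z \<noteq> -1" by blast
  then show ?thesis using disc_to_lens_cayley[OF assms] by cases auto
qed

lemma disc_to_lens_eq_0_iff:
  assumes "0 < \<alpha>" "\<alpha> < 2" "cmod z \<le> 1"
  shows "disc_to_lens \<alpha> z = 0 \<longleftrightarrow> z = 0"
proof -
  consider "z = 1" | "z = -1" | "z \<noteq> 1" "z \<noteq> -1" by blast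
  then show ?thesis
  proof cases
    case 3
    obtain q where "q \<noteq> -1" "q = 1 \<Longrightarrow> z = 0" "disc_to_lens \<alpha> z = (q - 1) / (q + 1)"
      using disc_to_lens_cayley[OF assms 3] by metis
    then show ?thesis using disc_to_lens_ends[OF assms(1)] by (auto simp: add_eq_0_iff2)
  qed (use disc_to_lens_ends[OF assms(1)] in auto)
qed

lemma continuous_on_disc_to_lens:
  assumes "0 < \<alpha>" "\<alpha> < 2"
  shows "continuous_on (cball 0 1) (disc_to_lens \<alpha>)"
proof -
  have "0 \<le> 1 + Re z" "Re z \<le> 1" if "cmod z \<le> 1" for z
    using abs_Re_le_cmod[of z] that by auto
  then have "continuous_on (cball 0 1) (\<lambda>z. (1 + z) powr complex_of_real \<alpha>)"
    "continuous_on (cball 0 1) (\<lambda>z. (1 - z) powr complex_of_real \<alpha>)"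
    using assms by (auto intro!: continuous_on_powr_complex continuous_intros simp: dist_norm)
  then show ?thesis unfolding disc_to_lens_def
    using disc_to_lens_denominator[OF assms]
    by (intro continuous_on_divide continuous_on_diff continuous_on_add) (auto simp: dist_norm)
qed

lemma disc_not_nonpos:
  assumes "z \<in> ball (0::complex) 1" shows "1 + z \<notin> \<real>\<^sub>\<le>\<^sub>0" "1 - z \<notin> \<real>\<^sub>\<le>\<^sub>0"
  using abs_Re_le_cmod[of z] assms by (auto simp: complex_nonpos_Reals_iff dist_norm)

lemma holomorphic_on_disc_to_lens:
  assumes "0 < \<alpha>" "\<alpha> < 2"
  shows "disc_to_lens \<alpha> holomorphic_on ball 0 1"
  unfolding disc_to_lens_def
  using disc_not_nonpos disc_to_lens_denominator[OF assms]
  by (intro holomorphic_intros) (auto simp: dist_norm)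

lemma deriv_disc_to_lens:
  assumes "0 < \<alpha>" "\<alpha> < 2"
  shows "deriv (disc_to_lens \<alpha>) 0 = of_real \<alpha>"
proof (rule DERIV_imp_deriv)
  show "(disc_to_lens \<alpha> has_field_derivative of_real \<alpha>) (at 0)"
    unfolding disc_to_lens_def 
    by (auto intro!: derivative_eq_intros simp: field_simps)
qed

text \<open>
  The only zero of the map in the closed disc is a simple one at the origin, where the derivative is
  \<open>\<alpha>\<close>. Dividing it out allows powers of \<open>z\<close> to be traded for powers of the map.
\<close>

lemma disc_to_lens_quotient:
  assumes \<alpha>: "0 < \<alpha>" "\<alpha> < 2"
  obtains k where "k holomorphic_on ball 0 1" "continuous_on (cball 0 1) k"
    "\<And>z. cmod z \<le> 1 \<Longrightarrow> k z \<noteq> 0" "\<And>z. disc_to_lens \<alpha> z = z * k z"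
proof -
  define k where "k = (\<lambda>z. if z = 0 then deriv (disc_to_lens \<alpha>) 0
    else (disc_to_lens \<alpha> z - disc_to_lens \<alpha> 0) / (z - 0))"
  have hol: "k holomorphic_on ball 0 1"
    unfolding k_def by (intro pole_lemma_open holomorphic_on_disc_to_lens \<alpha>) auto
  have "continuous (at z within cball 0 1) k" if "cmod z \<le> 1" for z
  proof (cases "z = 0")
    case True
    then have "isCont k z" 
      using holomorphic_on_imp_continuous_on[OF hol] by (simp add: continuous_on_eq_continuous_at)
    then show ?thesis by (rule continuous_at_imp_continuous_within)
  next
    case False
    have "continuous (at z within cball 0 1) (\<lambda>z. disc_to_lens \<alpha> z / z)"
      using continuous_on_disc_to_lens[OF \<alpha>] that False
      by (intro continuous_intros) (auto simp: continuous_on_eq_continuous_within)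
    then show ?thesis
    proof (rule continuous_transform_within[where \<delta> = "cmod z"])
      show "disc_to_lens \<alpha> y / y = k y" if "dist y z < cmod z" for y
        using that disc_to_lens_ends[OF \<alpha>(1)] by (auto simp: k_def dist_norm)
    qed (use False that in auto)
  qed
  then have "continuous_on (cball 0 1) k" by (simp add: continuous_on_eq_continuous_within)
  moreover have "k z \<noteq> 0" if "cmod z \<le> 1" for z
    using disc_to_lens_eq_0_iff[OF \<alpha> that] \<alpha> disc_to_lens_ends[OF \<alpha>(1)]
    by (simp add: k_def deriv_disc_to_lens)
  moreover have "disc_to_lens \<alpha> z = z * k z" for z
    using disc_to_lens_ends[OF \<alpha>(1)] by (simp add: k_def)
  ultimately show ?thesis using hol that by blast
qed

lemma maximum_modulus_unit_disc:
  assumes "h holomorphic_on ball 0 1" "continuous_on (cball 0 1) h"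
    and "\<And>z. cmod z = 1 \<Longrightarrow> cmod (h z) \<le> M" and "cmod z \<le> 1"
  shows "cmod (h z) \<le> M"
proof (cases "cmod z = 1")
  case False
  show ?thesis
    by (rule maximum_modulus_frontier[of h "ball 0 1"]) (use False assms in \<open>auto simp: dist_norm\<close>)
qed (use assms in auto)

text \<open>
  Schwarz's lemma for a polynomial that vanishes to order \<open>d\<close> at the centre of the lens: divide by
  \<open>z ^ d\<close> before applying the maximum principle.
\<close>

lemma schwarz_high_order:
  fixes c :: "'i \<Rightarrow> complex" and e :: "'i \<Rightarrow> nat"
  assumes \<alpha>: "0 < \<alpha>" "\<alpha> < 2"
    and high: "\<And>i. i \<in> I \<Longrightarrow> d \<le> e i"
    and bd: "\<And>z. cmod z = 1 \<Longrightarrow> cmod (\<Sum>i\<in>I. c i * disc_to_lens \<alpha> z ^ e i) \<le> M"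
    and z: "cmod z \<le> 1"
  shows "cmod (\<Sum>i\<in>I. c i * disc_to_lens \<alpha> z ^ e i) \<le> M * cmod z ^ d"
proof -
  obtain k where k: "k holomorphic_on ball 0 1" "continuous_on (cball 0 1) k"
    "\<And>z. cmod z \<le> 1 \<Longrightarrow> k z \<noteq> 0" "\<And>z. disc_to_lens \<alpha> z = z * k z"
    using disc_to_lens_quotient[OF \<alpha>] by blast
  define h where "h = (\<lambda>z. \<Sum>i\<in>I. c i * (z ^ (e i - d) * k z ^ e i))"
  have eq: "(\<Sum>i\<in>I. c i * disc_to_lens \<alpha> z ^ e i) = z ^ d * h z" for z
  proof -
    have "c i * disc_to_lens \<alpha> z ^ e i = z ^ d * (c i * (z ^ (e i - d) * k z ^ e i))" if "i \<in> I" for i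
    proof -
      have "z ^ e i = z ^ d * z ^ (e i - d)" using high[OF that] by (simp flip: power_add)
      then show ?thesis by (simp add: k(4) power_mult_distrib)
    qed
    then show ?thesis unfolding h_def sum_distrib_left by (intro sum.cong) auto
  qed
  have "cmod (h z) \<le> M"
  proof (rule maximum_modulus_unit_disc[OF _ _ _ z])
    show "h holomorphic_on ball 0 1" unfolding h_def using k by (intro holomorphic_intros)
    show "continuous_on (cball 0 1) h" unfolding h_def using k by (intro continuous_intros)
    show "cmod (h z) \<le> M" if "cmod z = 1" for z
      using bd[OF that] that unfolding eq by (simp add: norm_mult norm_power)
  qed
  then have "cmod z ^ d * cmod (h z) \<le> cmod z ^ d * M" by (intro mult_left_mono) auto
  then show ?thesis unfolding eq norm_mult norm_power by (simp add: mult.commute)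
qed

text \<open>
  The Bernstein-Walsh counterpart in the exterior of the lens: a polynomial of degree \<open>d\<close> has a pole
  of order at most \<open>d\<close> at infinity, which the factor \<open>z ^ d\<close> removes.
\<close>

lemma schwarz_low_degree:
  fixes c :: "'i \<Rightarrow> complex" and e :: "'i \<Rightarrow> nat"
  assumes \<alpha>: "0 < \<alpha>" "\<alpha> < 2"
    and low: "\<And>i. i \<in> I \<Longrightarrow> e i \<le> d"
    and bd: "\<And>z. cmod z = 1 \<Longrightarrow> cmod (\<Sum>i\<in>I. c i * (1 / disc_to_lens \<alpha> z) ^ e i) \<le> M"
    and z: "cmod z \<le> 1" "z \<noteq> 0"
  shows "cmod z ^ d * cmod (\<Sum>i\<in>I. c i * (1 / disc_to_lens \<alpha> z) ^ e i) \<le> M"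
proof -
  obtain k where k: "k holomorphic_on ball 0 1" "continuous_on (cball 0 1) k"
    "\<And>z. cmod z \<le> 1 \<Longrightarrow> k z \<noteq> 0" "\<And>z. disc_to_lens \<alpha> z = z * k z"
    using disc_to_lens_quotient[OF \<alpha>] by blast
  define h where "h = (\<lambda>z. \<Sum>i\<in>I. c i * (z ^ (d - e i) * (1 / k z) ^ e i))"
  have eq: "h z = z ^ d * (\<Sum>i\<in>I. c i * (1 / disc_to_lens \<alpha> z) ^ e i)" if "z \<noteq> 0" for z
  proof -
    have "z ^ d * (c i * (1 / disc_to_lens \<alpha> z) ^ e i) = c i * (z ^ (d - e i) * (1 / k z) ^ e i)" if "i \<in> I" for i
    proof -
      have *: "z ^ d = z ^ (d - e i) * z ^ e i" using low[OF that] by (simp flip: power_add)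
      have "z ^ e i * (1 / disc_to_lens \<alpha> z) ^ e i = (1 / k z) ^ e i"
        unfolding power_mult_distrib[symmetric] k(4) using \<open>z \<noteq> 0\<close> by simp
      then show ?thesis unfolding * by (metis mult.assoc mult.left_commute)
    qed
    then have "(\<Sum>i\<in>I. z ^ d * (c i * (1 / disc_to_lens \<alpha> z) ^ e i)) = h z"
      unfolding h_def by (rule sum.cong[OF refl])
    then show ?thesis unfolding sum_distrib_left by (rule sym)
  qed
  have "cmod (h z) \<le> M"
  proof (rule maximum_modulus_unit_disc[OF _ _ _ z(1)])
    show "h holomorphic_on ball 0 1" unfolding h_def using k by (intro holomorphic_intros) auto
    show "continuous_on (cball 0 1) h" unfolding h_def using k by (intro continuous_intros) auto
    show "cmod (h z) \<le> M" if "cmod z = 1" for z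
    proof -
      have "z \<noteq> 0" using that by auto
      then show ?thesis using bd[OF that] that by (simp add: eq norm_mult norm_power)
    qed
  qed
  then show ?thesis unfolding eq[OF z(2)] by (simp add: norm_mult norm_power)
qed

text \<open>
  With \<open>q\<close> as above, the reciprocal of \<open>(q - 1) / (q + 1)\<close> has the Cayley coordinate \<open>- q\<close>.
\<close>

lemma disc_to_lens_circle:
  assumes "0 < \<alpha>" "\<alpha> < 2" "cmod z = 1"
  shows "disc_to_lens \<alpha> z \<in> lens_boundary (cos (\<alpha> * pi / 2))"
    and "1 / disc_to_lens \<alpha> z \<in> lens_boundary (- cos (\<alpha> * pi / 2))"
proof -
  consider "z = 1" | "z = -1" | "z \<noteq> 1" "z \<noteq> -1" by blast
  then have "disc_to_lens \<alpha> z \<in> lens_boundary (cos (\<alpha> * pi / 2))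
    \<and> 1 / disc_to_lens \<alpha> z \<in> lens_boundary (- cos (\<alpha> * pi / 2))"
  proof cases
    case 3
    obtain q where q: "q \<noteq> 0" "disc_to_lens \<alpha> z = (q - 1) / (q + 1)"
        "Re q = cos (\<alpha> * pi / 2) * cmod q"
      using disc_to_lens_cayley[OF assms(1,2) _ 3] assms(3) by (metis order_refl)
    have "1 / disc_to_lens \<alpha> z = (- q - 1) / (- q + 1)"
    proof -
      have *: "- q - 1 = - (q + 1)" "- q + 1 = - (q - 1)" by auto
      show ?thesis unfolding q(2) * minus_divide_divide by simp
    qed
    then have "1 / disc_to_lens \<alpha> z \<in> lens_boundary (- cos (\<alpha> * pi / 2))"
      unfolding lens_boundary_def using q by (intro UnI2 CollectI exI[of _ "- q"]) simp
    moreover have "disc_to_lens \<alpha> z \<in> lens_boundary (cos (\<alpha> * pi / 2))"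
      unfolding lens_boundary_def using q by (intro UnI2 CollectI exI[of _ q]) simp
    ultimately show ?thesis by blast
  qed (use assms in \<open>auto simp: disc_to_lens_ends lens_boundary_def\<close>)
  then show "disc_to_lens \<alpha> z \<in> lens_boundary (cos (\<alpha> * pi / 2))"
    and "1 / disc_to_lens \<alpha> z \<in> lens_boundary (- cos (\<alpha> * pi / 2))" by auto
qed

text \<open>
  On the real segment the inverse of the power map with exponent \<open>\<alpha>\<close> is the one with exponent \<open>1/\<alpha>\<close>.
\<close>

lemma disc_to_lens_real_inverse:
  fixes r \<alpha> \<beta> :: real
  assumes "0 < \<alpha>" "\<alpha> * \<beta> = 1" "0 \<le> r" "r \<le> 1"
  defines "x \<equiv> ((1 + r) powr \<beta> - (1 - r) powr \<beta>) / ((1 + r) powr \<beta> + (1 - r) powr \<beta>)"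
  shows "disc_to_lens \<alpha> (of_real x) = of_real r" "0 \<le> x" "x \<le> 1" "x = 0 \<Longrightarrow> r = 0"
proof -
  define A where "A = (1 + r) powr \<beta>"
  define B where "B = (1 - r) powr \<beta>"
  have \<beta>: "0 < \<beta>" using assms by (metis mult_pos_pos not_one_less_zero zero_less_mult_pos zero_less_one)
  have A: "0 < A" "A powr \<alpha> = 1 + r" using assms by (auto simp: A_def powr_powr mult.commute)
  have B: "0 \<le> B" "B powr \<alpha> = 1 - r" using assms by (auto simp: B_def powr_powr mult.commute)
  have BA: "B \<le> A" unfolding A_def B_def using assms \<beta> by (intro powr_mono2) auto
  have x: "x = (A - B) / (A + B)" by (simp add: x_def A_def B_def)
  have AB: "0 < A + B" using A B by simp
  show "0 \<le> x" "x \<le> 1" using A(1) B(1) BA AB by (auto simp: x field_simps)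
  show "r = 0" if "x = 0"
  proof -
    have "A = B" using that AB by (simp add: x)
    then show ?thesis using A B by simp
  qed
  have "1 + x = 2 / (A + B) * A" "1 - x = 2 / (A + B) * B" using AB by (auto simp: x field_simps)
  then have p: "(1 + x) powr \<alpha> = (2 / (A + B)) powr \<alpha> * (1 + r)" "(1 - x) powr \<alpha> = (2 / (A + B)) powr \<alpha> * (1 - r)"
    using A B AB by (simp_all only: powr_mult)
  have c: "(1 + complex_of_real x) powr of_real \<alpha> = of_real ((1 + x) powr \<alpha>)"
     "(1 - complex_of_real x) powr of_real \<alpha> = of_real ((1 - x) powr \<alpha>)"
    using powr_of_real[of "1 + x" \<alpha>] powr_of_real[of "1 - x" \<alpha>] \<open>0 \<le> x\<close> \<open>x \<le> 1\<close> by auto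
  have "disc_to_lens \<alpha> (of_real x) = of_real (((1 + x) powr \<alpha> - (1 - x) powr \<alpha>) / ((1 + x) powr \<alpha> + (1 - x) powr \<alpha>))"
    unfolding disc_to_lens_def c by simp
  also have "((1 + x) powr \<alpha> - (1 - x) powr \<alpha>) / ((1 + x) powr \<alpha> + (1 - x) powr \<alpha>) = r"
  proof -
    have "(2 / (A + B)) powr \<alpha> > 0" using AB by simp
    then show ?thesis unfolding p by (simp add: field_simps)
  qed
  finally show "disc_to_lens \<alpha> (of_real x) = of_real r" .
qed

section \<open>Decay on tail spaces and a reverse bound for low degree\<close>

lemma theta_bounds:
  assumes "1 < p"
  shows "0 < theta p" "theta p \<le> pi" "cos (theta p / 2) = \<bar>1 - 2/p\<bar>"
proof -
  define x where "x = 2 * sqrt (p - 1) / p"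
  have x2: "1 - x\<^sup>2 = (1 - 2/p)\<^sup>2"
    using assms by (simp add: x_def power_divide power_mult_distrib field_simps power2_eq_square)
  have x0: "0 < x" using assms by (simp add: x_def)
  have "0 \<le> 1 - x\<^sup>2" unfolding x2 by simp
  then have "x\<^sup>2 \<le> 1\<^sup>2" by simp
  then have x1: "x \<le> 1" by (rule power2_le_imp_le) simp
  have "arcsin x > 0" using arcsin_less_mono[of 0 x] x0 x1 by simp
  moreover have "arcsin x \<le> pi/2" using arcsin_ubound[of x] x0 x1 by simp
  ultimately show "0 < theta p" "theta p \<le> pi" by (auto simp: theta_def x_def)
  show "cos (theta p / 2) = \<bar>1 - 2/p\<bar>"
    using cos_arcsin[of x] x0 x1 by (simp add: theta_def flip: x_def) (simp add: x2)
qed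

lemma noise_pairing_supported:
  assumes "\<And>A. A \<subseteq> {1..n} \<Longrightarrow> \<not> P A \<Longrightarrow> walsh_coeff n f A = 0"
  shows "(\<Sum>\<epsilon>\<in>cube n. noise n w f \<epsilon> * g \<epsilon>)
    = (\<Sum>A | A \<subseteq> {1..n} \<and> P A. (2 ^ n * walsh_coeff n f A * walsh_coeff n g A) * w ^ card A)"
  unfolding noise_pairing by (rule sum.mono_neutral_right) (auto simp: assms)

lemma noise_pairing_le:
  assumes p: "1 < p" "1 < q" "1/p + 1/q = 1" and w: "w \<in> lens_boundary \<bar>1 - 2/p\<bar>"
  shows "cmod (\<Sum>\<epsilon>\<in>cube n. noise n w f \<epsilon> * g \<epsilon>) \<le> lp_norm (cube n) p f * lp_norm (cube n) q g"
proof -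
  have "cmod (\<Sum>\<epsilon>\<in>cube n. noise n w f \<epsilon> * g \<epsilon>) \<le> lp_norm (cube n) p (noise n w f) * lp_norm (cube n) q g"
    using p by (intro holder_pairing) auto
  also have "\<dots> \<le> lp_norm (cube n) p f * lp_norm (cube n) q g"
    using noise_contraction[OF p(1) w] by (intro mult_right_mono lp_norm_nonneg)
  finally show ?thesis .
qed

text \<open>
  Pairing with \<open>g\<close> in the dual space turns the noise operator into a polynomial in \<open>w\<close> which has no
  terms below degree \<open>d\<close> and is bounded on the boundary of the lens by contractivity. The lens has
  angle \<open>theta p\<close> at its corners.
\<close>

lemma tail_space_decay:
  assumes p: "1 < p" and f: "f \<in> tail_space n d" and r: "0 \<le> r" "r \<le> 1"
  defines "\<beta> \<equiv> pi / theta p"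
  shows "lp_norm (cube n) p (noise n (of_real r) f)
    \<le> (((1 + r) powr \<beta> - (1 - r) powr \<beta>) / ((1 + r) powr \<beta> + (1 - r) powr \<beta>)) ^ d * lp_norm (cube n) p f"
proof -
  define q where "q = p / (p - 1)"
  have q: "1 < q" "1/p + 1/q = 1" using p by (auto simp: q_def field_simps)
  define \<alpha> where "\<alpha> = theta p / pi"
  note \<theta> = theta_bounds[OF p]
  have \<alpha>: "0 < \<alpha>" "\<alpha> < 2" "\<alpha> * \<beta> = 1" "cos (\<alpha> * pi / 2) = \<bar>1 - 2/p\<bar>"
    using \<theta> by (auto simp: \<alpha>_def \<beta>_def field_simps)
  define x where "x = ((1 + r) powr \<beta> - (1 - r) powr \<beta>) / ((1 + r) powr \<beta> + (1 - r) powr \<beta>)"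
  note x = disc_to_lens_real_inverse[OF \<alpha>(1,3) r, folded x_def]
  have supp: "walsh_coeff n f A = 0" if "A \<subseteq> {1..n}" "\<not> d \<le> card A" for A
    using f that by (auto simp: tail_space_def)
  show ?thesis unfolding x_def[symmetric]
  proof (rule lp_norm_le_by_duality[OF _ p q])
    show "0 \<le> x ^ d * lp_norm (cube n) p f" using x by (simp add: lp_norm_nonneg)
    fix g
    define c where "c = (\<lambda>A. 2 ^ n * walsh_coeff n f A * walsh_coeff n g A)"
    have pair: "(\<Sum>\<epsilon>\<in>cube n. noise n w f \<epsilon> * g \<epsilon>) = (\<Sum>A | A \<subseteq> {1..n} \<and> d \<le> card A. c A * w ^ card A)" for w
      unfolding c_def by (rule noise_pairing_supported) (use supp in auto)
    have "cmod (\<Sum>A | A \<subseteq> {1..n} \<and> d \<le> card A. c A * disc_to_lens \<alpha> (of_real x) ^ card A)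
      \<le> (lp_norm (cube n) p f * lp_norm (cube n) q g) * cmod (of_real x) ^ d"
    proof (rule schwarz_high_order[OF \<alpha>(1,2)])
      fix z :: complex assume "cmod z = 1"
      then show "cmod (\<Sum>A | A \<subseteq> {1..n} \<and> d \<le> card A. c A * disc_to_lens \<alpha> z ^ card A)
         \<le> lp_norm (cube n) p f * lp_norm (cube n) q g"
        unfolding pair[symmetric] using disc_to_lens_circle(1)[OF \<alpha>(1,2)] \<alpha>(4)
        by (intro noise_pairing_le p q) auto
    qed (use x in auto)
    then show "cmod (\<Sum>\<epsilon>\<in>cube n. noise n (of_real r) f \<epsilon> * g \<epsilon>) \<le> x ^ d * lp_norm (cube n) p f * lp_norm (cube n) q g"
      unfolding pair using x by (simp add: mult_ac)
  qed
qed

text \<open>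
  The noised function \<open>F\<close> has degree at most \<open>d\<close>, and \<open>f\<close> is recovered from it by the noise operator at
  \<open>1/r\<close>, a point outside the lens. The exterior of the lens has angle \<open>2 * pi - theta p\<close> at the corners.
\<close>

lemma degree_reverse_bound:
  assumes p: "1 < p" and f: "degree_at_most n d f" and r: "0 < r" "r \<le> 1"
  defines "\<beta> \<equiv> pi / (2 * pi - theta p)"
  shows "(((1 + r) powr \<beta> - (1 - r) powr \<beta>) / ((1 + r) powr \<beta> + (1 - r) powr \<beta>)) ^ d * lp_norm (cube n) p f
    \<le> lp_norm (cube n) p (noise n (of_real r) f)"
proof -
  define q where "q = p / (p - 1)"
  have q: "1 < q" "1/p + 1/q = 1" using p by (auto simp: q_def field_simps)
  define \<alpha> where "\<alpha> = (2 * pi - theta p) / pi"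
  note \<theta> = theta_bounds[OF p]
  have half: "\<alpha> * pi / 2 = pi - theta p / 2" by (simp add: \<alpha>_def field_simps)
  have "- cos (\<alpha> * pi / 2) = \<bar>1 - 2/p\<bar>" unfolding half using \<theta> by (simp add: cos_diff)
  moreover have "2 * pi - theta p > 0" using \<theta> pi_gt_zero by linarith
  ultimately have \<alpha>: "0 < \<alpha>" "\<alpha> < 2" "\<alpha> * \<beta> = 1" "- cos (\<alpha> * pi / 2) = \<bar>1 - 2/p\<bar>"
    using \<theta> by (auto simp: \<alpha>_def \<beta>_def field_simps)
  define x where "x = ((1 + r) powr \<beta> - (1 - r) powr \<beta>) / ((1 + r) powr \<beta> + (1 - r) powr \<beta>)"
  note x = disc_to_lens_real_inverse[OF \<alpha>(1,3) less_imp_le[OF r(1)] r(2), folded x_def]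
  have x0: "0 < x" using x r by (cases "x = 0") auto
  define F where "F = noise n (of_real r) f"
  have Ff: "noise n (1 / of_real r) F \<epsilon> = f \<epsilon>" if "\<epsilon> \<in> cube n" for \<epsilon>
    using noise_one[OF that, of f] r by (simp add: F_def noise_noise)
  have supp: "walsh_coeff n F A = 0" if "A \<subseteq> {1..n}" "\<not> card A \<le> d" for A
    using f that by (simp add: F_def walsh_coeff_noise degree_at_most_def)
  have "lp_norm (cube n) p f \<le> lp_norm (cube n) p F / x ^ d"
  proof (rule lp_norm_le_by_duality[OF _ p q])
    show "0 \<le> lp_norm (cube n) p F / x ^ d" using x by (simp add: lp_norm_nonneg)
    fix g
    define c where "c = (\<lambda>A. 2 ^ n * walsh_coeff n F A * walsh_coeff n g A)"
    have pair: "(\<Sum>\<epsilon>\<in>cube n. noise n w F \<epsilon> * g \<epsilon>) = (\<Sum>A | A \<subseteq> {1..n} \<and> card A \<le> d. c A * w ^ card A)" for w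
      unfolding c_def by (rule noise_pairing_supported) (use supp in auto)
    have "cmod (of_real x) ^ d * cmod (\<Sum>A | A \<subseteq> {1..n} \<and> card A \<le> d. c A * (1 / disc_to_lens \<alpha> (of_real x)) ^ card A)
      \<le> lp_norm (cube n) p F * lp_norm (cube n) q g"
    proof (rule schwarz_low_degree[OF \<alpha>(1,2)])
      fix z :: complex assume "cmod z = 1"
      then show "cmod (\<Sum>A | A \<subseteq> {1..n} \<and> card A \<le> d. c A * (1 / disc_to_lens \<alpha> z) ^ card A)
         \<le> lp_norm (cube n) p F * lp_norm (cube n) q g"
        unfolding pair[symmetric] using disc_to_lens_circle(2)[OF \<alpha>(1,2)] \<alpha>(4)
        by (intro noise_pairing_le p q) auto
    qed (use x x0 in auto)
    then have "x ^ d * cmod (\<Sum>\<epsilon>\<in>cube n. noise n (1 / of_real r) F \<epsilon> * g \<epsilon>) \<le> lp_norm (cube n) p F * lp_norm (cube n) q g"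
      unfolding pair x(1) using x0 by simp
    moreover have "(\<Sum>\<epsilon>\<in>cube n. noise n (1 / of_real r) F \<epsilon> * g \<epsilon>) = (\<Sum>\<epsilon>\<in>cube n. f \<epsilon> * g \<epsilon>)"
      by (intro sum.cong refl) (simp add: Ff)
    ultimately show "cmod (\<Sum>\<epsilon>\<in>cube n. f \<epsilon> * g \<epsilon>) \<le> lp_norm (cube n) p F / x ^ d * lp_norm (cube n) q g"
      using x0 by (simp add: field_simps)
  qed
  then show ?thesis unfolding x_def[symmetric] F_def using x0 by (simp add: field_simps)
qed

lemma cube_norm_eq: "cube_norm n p f = lp_norm (cube n) p f / (2 ^ n) powr (1/p)"
  by (simp add: cube_norm_def lp_norm_def powr_divide sum_nonneg)

lemma heat_eq_noise: "heat n t f = noise n (of_real (exp (- t))) f"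
proof
  have "exp (- t * real k) = exp (- t) ^ k" for k
    by (metis exp_of_nat_mult mult.commute)
  then show "heat n t f \<epsilon> = noise n (of_real (exp (- t))) f \<epsilon>" for \<epsilon>
    unfolding heat_def noise_def by (simp only: of_real_power)
qed

theorem theorem11:
  fixes p :: real and n d :: nat
  assumes "1 < p" and "1 \<le> n" and "d \<le> n"
  shows "(\<forall>f. degree_at_most n d f \<longrightarrow>
            (\<forall>t\<ge>0. cube_norm n p (heat n t f) \<ge>
               (((exp t + 1) powr (pi / (2 * pi - theta p)) - (exp t - 1) powr (pi / (2 * pi - theta p))) /
                ((exp t + 1) powr (pi / (2 * pi - theta p)) + (exp t - 1) powr (pi / (2 * pi - theta p)))) ^ d
               * cube_norm n p f)) \<and>
         (\<forall>f\<in>tail_space n d.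
            (\<forall>t\<ge>0. cube_norm n p (heat n t f) \<le>
               (((1 + exp (- t)) powr (pi / theta p) - (1 - exp (- t)) powr (pi / theta p)) /
                ((1 + exp (- t)) powr (pi / theta p) + (1 - exp (- t)) powr (pi / theta p))) ^ d
               * cube_norm n p f))"
proof (intro conjI allI ballI impI)
  fix f and t :: real assume f: "degree_at_most n d f" and t: "0 \<le> t"
  define \<beta> where "\<beta> = pi / (2 * pi - theta p)"
  define r where "r = exp (- t)"
  have r: "0 < r" "r \<le> 1" using t by (auto simp: r_def)
  have "exp t + 1 = exp t * (1 + r)" "exp t - 1 = exp t * (1 - r)"
    by (auto simp: r_def algebra_simps simp flip: exp_add)
  then have "((exp t + 1) powr \<beta> - (exp t - 1) powr \<beta>) / ((exp t + 1) powr \<beta> + (exp t - 1) powr \<beta>)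
    = ((1 + r) powr \<beta> - (1 - r) powr \<beta>) / ((1 + r) powr \<beta> + (1 - r) powr \<beta>)"
    by (simp only: powr_mult flip: distrib_left right_diff_distrib) simp
  moreover have "0 \<le> (2 ^ n) powr (1/p)" by simp
  ultimately show "cube_norm n p (heat n t f) \<ge>
       (((exp t + 1) powr (pi / (2 * pi - theta p)) - (exp t - 1) powr (pi / (2 * pi - theta p))) /
        ((exp t + 1) powr (pi / (2 * pi - theta p)) + (exp t - 1) powr (pi / (2 * pi - theta p)))) ^ d
       * cube_norm n p f"
    using degree_reverse_bound[OF assms(1) f r]
    unfolding cube_norm_eq heat_eq_noise \<beta>_def[symmetric] r_def[symmetric]
    by (simp add: divide_right_mono)
next
  fix f and t :: real assume f: "f \<in> tail_space n d" and t: "0 \<le> t"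
  have "0 \<le> exp (- t)" "exp (- t) \<le> 1" using t by auto
  from tail_space_decay[OF assms(1) f this]
  show "cube_norm n p (heat n t f) \<le>
       (((1 + exp (- t)) powr (pi / theta p) - (1 - exp (- t)) powr (pi / theta p)) /
        ((1 + exp (- t)) powr (pi / theta p) + (1 - exp (- t)) powr (pi / theta p))) ^ d
       * cube_norm n p f"
    unfolding cube_norm_eq heat_eq_noise by (simp add: divide_right_mono)
qed

end
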